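(* There are absolute constants $c_0,c_1>0$ such that the following holds. Let $N,d\ge1$ and $K\in\{1,\dots,N\}$ be integers with $K$ dividing $N$. Let $\tilde X_1,\dots,\tilde X_N$ be independent random vectors in $\mathbb{R}^d$ with mean $\mu$ and invertible covariance matrix $\Sigma$. Let $X_1,\dots,X_N$ be an adversarially corrupted version of them in which at most $|\mathcal{O}|$ vectors have been modified. Assume that for some $0<\epsilon<1/8$ and constants $0<\varphi_l(\epsilon)<\varphi_u(\epsilon)$, for all $v\in\mathbb{R}^d$ with $\|v\|_2=1$, $$\max\left(W_v\left(\tfrac14-2\epsilon\right)-W_v\left(\tfrac12+2\epsilon\right),\,W_v\left(\tfrac12-2\epsilon\right)-W_v\left(\tfrac34+2\epsilon\right)\right)\le\varphi_u(\epsilon)$$ and $$\min\left(W_v\left(\tfrac14+2\epsilon\right)-W_v\left(\tfrac12-2\epsilon\right),\,W_v\left(\tfrac12+2\epsilon\right)-W_v\left(\tfrac34-2\epsilon\right)\right)\ge\varphi_l(\epsilon).$$ Assume that $|\mathcal{O}|\le\epsilon K$ and $K\ge c_0\epsilon^{-2}d$. Then, with probability at least $1-\exp(-c_1\epsilon^2K)$, for all $v\in\mathbb{R}^d$, $$\varphi_l(\epsilon)\sqrt{\frac KN}\,\|\Sigma^{1/2}v\|_2\le MOMAD_K(v)\le\varphi_u(\epsilon)\sqrt{\frac KN}\,\|\Sigma^{1/2}v\|_2.$$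
   Context: Blocks: $B_1\sqcup\dots\sqcup B_K=\{1,\dots,N\}$ is a fixed partition into $K$ blocks of equal size $N/K$, and $\bar X_k=\frac{1}{|B_k|}\sum_{i\in B_k}X_i$ are the block means of the corrupted data. $MOMAD_K(v)=\mathrm{Med}\left(|\langle\bar X_k,v\rangle-\mathrm{Med}(\langle\bar X_k,v\rangle)|\right)$, where the medians are over $k\in\{1,\dots,K\}$; $\mathrm{Med}$ is the usual empirical median (the middle order statistic for an odd number of terms, the midpoint of the two middle order statistics for an even number). For $\|v\|_2=1$, $r\in\mathbb{R}$ and $p\in(0,1)$ (in terms of the uncorrupted vectors): $$H_v(r)=H_{N,K,v}(r)=\mathbb{P}\left[\frac{1}{\sqrt{N/K}}\sum_{i=1}^{N/K}\langle\Sigma^{-1/2}(\tilde X_i-\mu),v\rangle\ge r\right],\qquad W_v(p)=\max\{r\in\mathbb{R}:H_v(r)\ge p\}.$$ Adversarial corruption: the adversary sees all of $\tilde X_1,\dots,\tilde X_N$ and replaces at most $|\mathcal{O}|$ of them by arbitrary vectors; the set $\mathcal{O}$ of modified indices and the new vectors may depend arbitrarily on all the $\tilde X_i$'s, and $X_i=\tilde X_i$ for $i\notin\mathcal{O}$. Here $|\mathcal{O}|$ is a deterministic upper bound on the number of modified vectors. "With probability at least $p$" means there is an event of probability at least $p$ on which the conclusion holds. Absolute constants depend on no parameter.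
   Formalization: Added assumption: in every unit direction, the standardized sum over each block has the same law as that over the first N/K vectors (automatic for i.i.d. data; the claim fails without it). Constants are given per type of sample points; the canonical data space yields ones valid for all. *)

theory Defs
  imports "HOL-Probability.Probability" "Jordan_Normal_Form.Gauss_Jordan_Elimination"
begin

text \<open>
  The dimension \<open>d\<close> must be quantified inside the absolute constants, so vectors and matrices
  are those of \<^theory>\<open>Jordan_Normal_Form.Matrix\<close>, whose dimension is not part of the type.
\<close>

definition euclid_norm :: "real Matrix.vec \<Rightarrow> real" where
  "euclid_norm v = sqrt (scalar_prod v v)"

text \<open>The Borel \<open>\<sigma>\<close>-algebra of \<open>\<real>\<^sup>d\<close>, generated by the coordinates.\<close>

definition borel_vec :: "nat \<Rightarrow> real Matrix.vec measure" where
  "borel_vec d = vimage_algebra (carrier_vec d)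
     (\<lambda>x. \<lambda>j\<in>{..<d}. vec_index x j) (Pi\<^sub>M {..<d} (\<lambda>_. borel))"

definition has_mean :: "'a measure \<Rightarrow> nat \<Rightarrow> ('a \<Rightarrow> real Matrix.vec) \<Rightarrow> real Matrix.vec \<Rightarrow> bool" where
  "has_mean M d Y \<mu> \<longleftrightarrow> \<mu> \<in> carrier_vec d \<and>
     (\<forall>j<d. integrable M (\<lambda>\<omega>. vec_index (Y \<omega>) j) \<and>
            integral\<^sup>L M (\<lambda>\<omega>. vec_index (Y \<omega>) j) = vec_index \<mu> j)"

definition has_covariance ::
  "'a measure \<Rightarrow> nat \<Rightarrow> ('a \<Rightarrow> real Matrix.vec) \<Rightarrow> real Matrix.vec \<Rightarrow> real mat \<Rightarrow> bool" where
  "has_covariance M d Y \<mu> S \<longleftrightarrow> S \<in> carrier_mat d d \<and>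
     (\<forall>i<d. \<forall>j<d.
        integrable M (\<lambda>\<omega>. (vec_index (Y \<omega>) i - vec_index \<mu> i) * (vec_index (Y \<omega>) j - vec_index \<mu> j)) \<and>
        integral\<^sup>L M (\<lambda>\<omega>. (vec_index (Y \<omega>) i - vec_index \<mu> i) * (vec_index (Y \<omega>) j - vec_index \<mu> j))
          = S $$ (i, j))"

text \<open>\<open>R\<close> is \<open>S\<^sup>1\<^sup>/\<^sup>2\<close>: the (unique) symmetric positive semidefinite matrix with square \<open>S\<close>.\<close>

definition is_psd_sqrt :: "nat \<Rightarrow> real mat \<Rightarrow> real mat \<Rightarrow> bool" where
  "is_psd_sqrt d R S \<longleftrightarrow> R \<in> carrier_mat d d \<and> transpose_mat R = R \<and>
     (\<forall>x\<in>carrier_vec d. 0 \<le> scalar_prod x (R *\<^sub>v x)) \<and> R * R = S"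

definition is_block_partition :: "nat \<Rightarrow> nat \<Rightarrow> (nat \<Rightarrow> nat set) \<Rightarrow> bool" where
  "is_block_partition N K B \<longleftrightarrow> (\<Union>k\<in>{1..K}. B k) = {1..N} \<and>
     disjoint_family_on B {1..K} \<and> (\<forall>k\<in>{1..K}. card (B k) = N div K)"

definition block_mean :: "nat \<Rightarrow> (nat \<Rightarrow> real Matrix.vec) \<Rightarrow> nat set \<Rightarrow> real Matrix.vec" where
  "block_mean d x I = Matrix.vec d (\<lambda>j. (\<Sum>i\<in>I. vec_index (x i) j) / real (card I))"

text \<open>Empirical median of \<open>f 1, \<dots>, f K\<close>; list positions start at \<open>0\<close>.\<close>

definition Med :: "nat \<Rightarrow> (nat \<Rightarrow> real) \<Rightarrow> real" where
  "Med K f = (let xs = sort (map f [1..<Suc K]) in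
     if odd K then xs ! (K div 2) else (xs ! (K div 2 - 1) + xs ! (K div 2)) / 2)"

definition MOMAD :: "nat \<Rightarrow> nat \<Rightarrow> (nat \<Rightarrow> nat set) \<Rightarrow> (nat \<Rightarrow> real Matrix.vec) \<Rightarrow> real Matrix.vec \<Rightarrow> real" where
  "MOMAD d K B x v =
     Med K (\<lambda>k. \<bar>scalar_prod (block_mean d x (B k)) v
                  - Med K (\<lambda>l. scalar_prod (block_mean d x (B l)) v)\<bar>)"

text \<open>
  Tail of the standardized sum over an index set \<open>I\<close>, with \<open>R\<close> in the role of the square root
  of the covariance matrix; \<open>mat_inverse\<close> is option-valued. The function \<open>H_fun\<close> is the case
  \<open>I = {1..N div K}\<close>.
\<close>

definition std_tail ::
  "'a measure \<Rightarrow> (nat \<Rightarrow> 'a \<Rightarrow> real Matrix.vec) \<Rightarrow> real Matrix.vec \<Rightarrow> real mat \<Rightarrow>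
   nat set \<Rightarrow> real Matrix.vec \<Rightarrow> real \<Rightarrow> real" where
  "std_tail M Y \<mu> R I v r = measure M {\<omega> \<in> space M.
     1 / sqrt (real (card I)) *
       (\<Sum>i\<in>I. scalar_prod (the (mat_inverse R) *\<^sub>v (Y i \<omega> - \<mu>)) v) \<ge> r}"

definition H_fun ::
  "'a measure \<Rightarrow> (nat \<Rightarrow> 'a \<Rightarrow> real Matrix.vec) \<Rightarrow> real Matrix.vec \<Rightarrow> real mat \<Rightarrow>
   nat \<Rightarrow> nat \<Rightarrow> real Matrix.vec \<Rightarrow> real \<Rightarrow> real" where
  "H_fun M Y \<mu> R N K v r = std_tail M Y \<mu> R {1..N div K} v r"

definition W_fun ::
  "'a measure \<Rightarrow> (nat \<Rightarrow> 'a \<Rightarrow> real Matrix.vec) \<Rightarrow> real Matrix.vec \<Rightarrow> real mat \<Rightarrow>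
   nat \<Rightarrow> nat \<Rightarrow> real Matrix.vec \<Rightarrow> real \<Rightarrow> real" where
  "W_fun M Y \<mu> R N K v p = (GREATEST r. H_fun M Y \<mu> R N K v r \<ge> p)"

text \<open>
  A single function \<open>H_fun\<close> describes every block only if the standardized block sums have the same
  one-dimensional laws as the sum over the first \<open>N div K\<close> indices. For identically distributed
  \<open>Y i\<close> this is automatic; independence with common mean and covariance does not imply it.
\<close>

definition common_block_law ::
  "'a measure \<Rightarrow> (nat \<Rightarrow> 'a \<Rightarrow> real Matrix.vec) \<Rightarrow> real Matrix.vec \<Rightarrow> real mat \<Rightarrow>
   nat \<Rightarrow> nat \<Rightarrow> nat \<Rightarrow> (nat \<Rightarrow> nat set) \<Rightarrow> bool" where
  "common_block_law M Y \<mu> R d N K B \<longleftrightarrow>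
     (\<forall>k\<in>{1..K}. \<forall>v\<in>carrier_vec d. euclid_norm v = 1 \<longrightarrow>
        (\<forall>r. std_tail M Y \<mu> R (B k) v r = H_fun M Y \<mu> R N K v r))"

text \<open>
  The modified indices and the new values may be arbitrary, even non-measurable, functions of
  the sample point; \<open>m\<close> is the deterministic bound on the number of modifications.
\<close>

definition corrupted_version ::
  "'a measure \<Rightarrow> nat \<Rightarrow> nat \<Rightarrow> nat \<Rightarrow> (nat \<Rightarrow> 'a \<Rightarrow> real Matrix.vec) \<Rightarrow>
   (nat \<Rightarrow> 'a \<Rightarrow> real Matrix.vec) \<Rightarrow> bool" where
  "corrupted_version M d N m Y X \<longleftrightarrow> (\<forall>\<omega>\<in>space M.
     (\<forall>i\<in>{1..N}. X i \<omega> \<in> carrier_vec d) \<and> card {i\<in>{1..N}. X i \<omega> \<noteq> Y i \<omega>} \<le> m)"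

end

theory Submission
  imports Defs
begin

text \<open>
  For a unit vector \<open>u\<close>, the numbers \<open>W_u(p)\<close> are upper quantiles of the standardized block sums in
  direction \<open>u\<close>, and with \<open>u = R v / \<parallel>R v\<parallel>\<close> those sums are an affine function, with slope
  \<open>sqrt (N/K) / \<parallel>R v\<parallel>\<close>, of the projected block means \<open>\<langle>X\<^sub>k, v\<rangle>\<close>. Suppose that for every half-line the
  proportion of blocks whose projection falls into it differs from its probability by less than
  \<open>2 \<epsilon>\<close>. Then each empirical quantile of order \<open>p\<close> lies between \<open>W_u(p + 2 \<epsilon>)\<close> and \<open>W_u(p - 2 \<epsilon>)\<close>. The
  median lies between two such numbers for \<open>p = 1/2\<close>, and the assumed gaps towards the quantiles of
  orders \<open>1/4\<close> and \<open>3/4\<close> bound the median distance to it from both sides (\<open>MAD_bounds\<close>). An adversary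
  affects at most \<open>\<epsilon> K\<close> blocks, whatever the choice of the modified vectors, so it suffices to
  control the uncorrupted block means up to less than \<open>\<epsilon> K\<close> blocks, simultaneously for all half-spaces.
  
  That is a uniform law of large numbers for the class of half-spaces in \<open>\<real>\<^sup>d\<close>. It has to hold for a
  number of blocks of order \<open>d / \<epsilon>\<^sup>2\<close> without a factor \<open>ln (1/\<epsilon>)\<close>, which rules out a single union
  bound over the traces of the class. Instead the sample is symmetrized with a ghost sample
  (\<open>symmetrization\<close>, \<open>swap_bound\<close>), which leaves a combinatorial problem about random signs on \<open>2 K\<close>
  fixed points. There a chaining argument (\<open>rademacher_chaining\<close>) passes through Hamming nets at dyadic
  scales; Dudley's packing bound (\<open>card_packing_le\<close>), a consequence of the Sauer-Shelah lemma, controls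
  their sizes at every scale. Half-spaces enter through their Vapnik-Chervonenkis dimension \<open>d + 1\<close>
  (\<open>halfspace_shatters_card_le\<close>) and through approximation by countably many rational ones
  (\<open>halfspace_approximation\<close>), which keeps all events measurable.
\<close>

section \<open>Shattering and packing numbers\<close>

definition shatters :: "'b set set \<Rightarrow> 'b set \<Rightarrow> bool" where
  "shatters F S \<longleftrightarrow> Pow S \<subseteq> (\<lambda>A. A \<inter> S) ` F"

lemma shattersD:
  assumes "shatters F S" "T \<subseteq> S"
  obtains A where "A \<in> F" "T = A \<inter> S"
proof -
  have "T \<in> (\<lambda>A. A \<inter> S) ` F" using assms by (auto simp: shatters_def)
  then show ?thesis using that by (elim imageE)
qed

lemma shattersI:
  assumes "\<And>T. T \<subseteq> S \<Longrightarrow> \<exists>A\<in>F. T = A \<inter> S"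
  shows "shatters F S"
  using assms by (simp add: shatters_def subset_iff[of "Pow S"] image_iff)

text \<open>
  Pajor's form of the Sauer-Shelah lemma. Splitting \<open>F\<close> along a point \<open>x\<close>, the family \<open>P \<union> Q\<close> of traces on
  the remaining points together with the family \<open>P \<inter> Q\<close> of traces that extend in both ways has as many
  members as \<open>F\<close>; sets shattered by \<open>P \<inter> Q\<close> remain shattered by \<open>F\<close> after \<open>x\<close> is added, so the two
  kinds of shattered sets do not overlap.
\<close>

lemma card_le_card_shattered:
  assumes "finite X" "F \<subseteq> Pow X"
  shows "card F \<le> card {S. S \<subseteq> X \<and> shatters F S}"
  using assms
proof (induction X arbitrary: F rule: finite_induct)
  case empty
  show ?case
  proof (cases "F = {}")
    case False
    with empty have "F = {{}}" by auto
    then have "{S. S \<subseteq> {} \<and> shatters F S} = {{}}" by (auto simp: shatters_def)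
    then show ?thesis using \<open>F = {{}}\<close> by simp
  qed simp
next
  case (insert x Y)
  define P where "P = F \<inter> Pow Y"
  define Q where "Q = (\<lambda>A. A - {x}) ` (F - Pow Y)"
  have fin: "finite F" "finite P" "finite Q"
    using insert.prems insert.hyps finite_subset[of F "Pow (insert x Y)"]
    by (auto simp: P_def Q_def)
  have sub: "P \<union> Q \<subseteq> Pow Y" "P \<inter> Q \<subseteq> Pow Y"
    using insert.prems by (auto simp: P_def Q_def)
  have xin: "x \<in> A" if "A \<in> F - Pow Y" for A
    using that insert.prems by blast
  have "inj_on (\<lambda>A. A - {x}) (F - Pow Y)"
    by (rule inj_onI) (metis insert_Diff xin)
  then have "card Q = card (F - Pow Y)" unfolding Q_def by (rule card_image)
  then have "card F = card P + card Q"
    unfolding P_def using fin(1) by (metis card_Int_Diff)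
  also have "\<dots> = card (P \<union> Q) + card (P \<inter> Q)"
    by (rule card_Un_Int[OF fin(2,3)])
  also have "\<dots> \<le> card {S. S \<subseteq> Y \<and> shatters (P \<union> Q) S} + card {S. S \<subseteq> Y \<and> shatters (P \<inter> Q) S}"
    using insert.IH[OF sub(1)] insert.IH[OF sub(2)] by linarith
  also have "card {S. S \<subseteq> Y \<and> shatters (P \<inter> Q) S} =
      card (Set.insert x ` {S. S \<subseteq> Y \<and> shatters (P \<inter> Q) S})"
  proof (rule card_image[symmetric], rule inj_onI)
    fix S T assume "S \<in> {S. S \<subseteq> Y \<and> shatters (P \<inter> Q) S}" "T \<in> {S. S \<subseteq> Y \<and> shatters (P \<inter> Q) S}"
      and eq: "insert x S = insert x T"
    then have "x \<notin> S" "x \<notin> T" using insert.hyps by blast+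
    then show "S = T" using eq by (simp add: insert_ident)
  qed
  also have "card {S. S \<subseteq> Y \<and> shatters (P \<union> Q) S} + \<dots> =
      card ({S. S \<subseteq> Y \<and> shatters (P \<union> Q) S} \<union> Set.insert x ` {S. S \<subseteq> Y \<and> shatters (P \<inter> Q) S})"
  proof (rule card_Un_disjoint[symmetric])
    show "finite {S. S \<subseteq> Y \<and> shatters (P \<union> Q) S}"
      "finite (Set.insert x ` {S. S \<subseteq> Y \<and> shatters (P \<inter> Q) S})"
      using insert.hyps(1) by auto
    show "{S. S \<subseteq> Y \<and> shatters (P \<union> Q) S} \<inter> Set.insert x ` {S. S \<subseteq> Y \<and> shatters (P \<inter> Q) S} = {}"
    proof (rule equals0I)
      fix S assume "S \<in> {S. S \<subseteq> Y \<and> shatters (P \<union> Q) S} \<inter>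
        Set.insert x ` {S. S \<subseteq> Y \<and> shatters (P \<inter> Q) S}"
      then have "S \<subseteq> Y" "x \<in> S" by auto
      then show False using insert.hyps(2) by (meson subsetD)
    qed
  qed
  also have "\<dots> \<le> card {S. S \<subseteq> insert x Y \<and> shatters F S}"
  proof (rule card_mono)
    show "finite {S. S \<subseteq> insert x Y \<and> shatters F S}" using insert.hyps by auto
    have 1: "shatters F S" if "S \<subseteq> Y" "shatters (P \<union> Q) S" for S
    proof -
      have "x \<notin> S" using that insert.hyps by auto
      have "\<exists>C\<in>F. T = C \<inter> S" if "T \<subseteq> S" for T
      proof -
        obtain A where "A \<in> P \<union> Q" "T = A \<inter> S"
          using shattersD[OF \<open>shatters (P \<union> Q) S\<close> \<open>T \<subseteq> S\<close>] by metis
        then obtain C where "C \<in> F" "A = C \<or> A = C - {x}" by (auto simp: P_def Q_def)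
        then show ?thesis using \<open>x \<notin> S\<close> \<open>T = A \<inter> S\<close> by (intro bexI[of _ C]) auto
      qed
      then show ?thesis by (rule shattersI)
    qed
    have 2: "shatters F (insert x S)" if "S \<subseteq> Y" "shatters (P \<inter> Q) S" for S
    proof -
      have "\<exists>C\<in>F. T = C \<inter> insert x S" if "T \<subseteq> insert x S" for T
      proof -
        have "T - {x} \<subseteq> S" using that by auto
        then obtain A where A: "A \<in> P \<inter> Q" "T - {x} = A \<inter> S"
          using shattersD[OF \<open>shatters (P \<inter> Q) S\<close>] by metis
        have "A \<in> F" "x \<notin> A" using A insert.hyps by (auto simp: P_def)
        obtain C where "C \<in> F - Pow Y" "A = C - {x}" using A by (auto simp: Q_def)
        then have "insert x A \<in> F" using xin[of C] by (simp add: insert_absorb)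
        show ?thesis
        proof (cases "x \<in> T")
          case True
          then show ?thesis using A that \<open>insert x A \<in> F\<close>
            by (intro bexI[of _ "insert x A"]) auto
        next
          case False
          then show ?thesis using A that \<open>A \<in> F\<close> \<open>x \<notin> A\<close>
            by (intro bexI[of _ A]) auto
        qed
      qed
      then show ?thesis by (rule shattersI)
    qed
    show "{S. S \<subseteq> Y \<and> shatters (P \<union> Q) S} \<union> Set.insert x ` {S. S \<subseteq> Y \<and> shatters (P \<inter> Q) S}
      \<subseteq> {S. S \<subseteq> insert x Y \<and> shatters F S}"
      using 1 2 by auto
  qed
  finally show ?case .
qed

lemma sauer_shelah:
  assumes "finite X" "F \<subseteq> Pow X" "\<And>S. shatters F S \<Longrightarrow> S \<subseteq> X \<Longrightarrow> card S \<le> D"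
  shows "card F \<le> (\<Sum>i\<le>D. card X choose i)"
proof -
  have "card F \<le> card {S. S \<subseteq> X \<and> shatters F S}"
    by (rule card_le_card_shattered[OF assms(1,2)])
  also have "\<dots> \<le> card (\<Union>i\<in>{..D}. {S. S \<subseteq> X \<and> card S = i})"
    using assms by (intro card_mono) auto
  also have "\<dots> \<le> (\<Sum>i\<le>D. card {S. S \<subseteq> X \<and> card S = i})"
    by (rule card_UN_le) simp
  also have "\<dots> = (\<Sum>i\<le>D. card X choose i)"
    by (simp add: n_subsets[OF assms(1)])
  finally show ?thesis .
qed

text \<open>
  The weights \<open>(D/s)\<^sup>i\<close> turn the partial row sum into part of the expansion of \<open>(1 + D/s)\<^sup>s\<close>. The factor
  \<open>1/D\<close> inside the power matters: the cruder bound \<open>(s + 1)\<^sup>D\<close> would cost a factor \<open>ln D\<close> in the sample size.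
\<close>

lemma sum_binomial_le_power:
  assumes "1 \<le> D" "D \<le> s"
  shows "real (\<Sum>i\<le>D. s choose i) \<le> (exp 1 * real s / real D) ^ D"
proof -
  define x where "x = real D / real s"
  have x: "0 < x" "x \<le> 1" using assms by (auto simp: x_def)
  have "real (\<Sum>i\<le>D. s choose i) * x ^ D = (\<Sum>i\<le>D. real (s choose i) * x ^ D)"
    by (simp add: sum_distrib_right)
  also have "\<dots> \<le> (\<Sum>i\<le>D. real (s choose i) * x ^ i)"
    using x by (intro sum_mono mult_left_mono power_decreasing) auto
  also have "\<dots> \<le> (\<Sum>i\<le>s. real (s choose i) * x ^ i)"
    using x assms by (intro sum_mono2) auto
  also have "\<dots> = (x + 1) ^ s"
    by (simp add: binomial_ring)
  also have "\<dots> \<le> exp x ^ s"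
    using x exp_ge_add_one_self[of x] by (intro power_mono) (auto simp: add.commute)
  also have "\<dots> = exp 1 ^ D"
    using assms by (simp add: x_def flip: exp_of_nat_mult)
  finally have "real (\<Sum>i\<le>D. s choose i) \<le> exp 1 ^ D / x ^ D"
    using x by (simp add: field_simps)
  then show ?thesis by (simp add: x_def power_divide power_mult_distrib)
qed

lemma shatters_trace:
  assumes "shatters ((\<lambda>A. A \<inter> S) ` F) T" "T \<subseteq> S"
  shows "shatters F T"
proof -
  have "A \<inter> S \<inter> T = A \<inter> T" for A using assms(2) by auto
  then show ?thesis using assms(1) unfolding shatters_def image_image by simp
qed

text \<open>
  The probabilistic method: \<open>s\<close> points drawn uniformly with replacement miss the symmetric difference
  of a fixed pair with probability at most \<open>(1 - \<delta>/card X)\<^sup>s\<close>, so a union bound over the pairs leaves a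
  draw that tells all members of \<open>W\<close> apart. The argument counts the draws as functions on \<open>{..<s}\<close>.
\<close>

lemma exists_distinguishing_subset:
  assumes X: "finite X" "W \<subseteq> Pow X" and ne: "X \<noteq> {}"
    and sep: "\<And>A B. A \<in> W \<Longrightarrow> B \<in> W \<Longrightarrow> A \<noteq> B \<Longrightarrow> \<delta> \<le> real (card (sym_diff A B))"
    and s: "(real (card W))\<^sup>2 * (real (card X) - \<delta>) ^ s < real (card X) ^ s"
  shows "\<exists>S\<subseteq>X. card S \<le> s \<and> inj_on (\<lambda>A. A \<inter> S) W"
proof -
  have finW: "finite W" using X finite_subset by fastforce
  define bad where "bad = (\<lambda>(A,B). PiE {..<s} (\<lambda>_. X - (sym_diff A B)))"
  define prs where "prs = {q. fst q \<in> W \<and> snd q \<in> W \<and> fst q \<noteq> snd q}"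
  have prs: "prs \<subseteq> W \<times> W" by (auto simp: prs_def)
  have finp: "finite prs" using prs finW finite_subset by blast
  have "card prs \<le> card (W \<times> W)" using prs finW by (intro card_mono) auto
  then have cp: "real (card prs) \<le> (real (card W))\<^sup>2"
    by (simp add: card_cartesian_product power2_eq_square flip: of_nat_mult)
  have finbad: "finite (bad q)" for q
    unfolding bad_def using X by (auto split: prod.splits intro!: finite_PiE)
  have badle: "real (card (bad q)) \<le> (real (card X) - \<delta>) ^ s" if "q \<in> prs" for q
  proof -
    define A B where "A = fst q" and "B = snd q"
    then have q: "q = (A, B)" "A \<in> W" "B \<in> W" "A \<noteq> B" using that by (simp_all add: prs_def)
    have D: "sym_diff A B \<subseteq> X" using q X by auto
    have "card (X - (sym_diff A B)) = card X - card (sym_diff A B)"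
      by (rule card_Diff_subset) (use D X finite_subset in auto)
    moreover have "card (sym_diff A B) \<le> card X" using D X by (intro card_mono) auto
    ultimately have "real (card (X - (sym_diff A B))) \<le> real (card X) - \<delta>"
      using sep[OF q(2-4)] by linarith
    then show ?thesis using q by (auto simp: bad_def card_PiE intro!: power_mono)
  qed
  have "real (card (\<Union>(bad ` prs))) \<le> real (\<Sum>q\<in>prs. card (bad q))"
    using card_UN_le[OF finp, of bad] by (simp del: of_nat_sum)
  also have "\<dots> \<le> (\<Sum>q\<in>prs. (real (card X) - \<delta>) ^ s)"
    unfolding of_nat_sum by (intro sum_mono badle)
  also have "\<dots> = real (card prs) * (real (card X) - \<delta>) ^ s" by simp
  also have "\<dots> < real (card X) ^ s"
  proof (cases "prs = {}")
    case True
    then show ?thesis using X ne by (simp add: card_gt_0_iff)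
  next
    case False
    then obtain A B where q: "A \<in> W" "B \<in> W" "A \<noteq> B" by (fastforce simp: prs_def)
    have "card (sym_diff A B) \<le> card X" using q X by (intro card_mono) auto
    then have "0 \<le> real (card X) - \<delta>" using sep[OF q] by linarith
    then have "real (card prs) * (real (card X) - \<delta>) ^ s
        \<le> (real (card W))\<^sup>2 * (real (card X) - \<delta>) ^ s"
      using cp by (intro mult_right_mono) auto
    then show ?thesis using s by simp
  qed
  also have "\<dots> = real (card (PiE {..<s} (\<lambda>_. X)))" by (simp add: card_PiE)
  finally have "card (\<Union>(bad ` prs)) < card (PiE {..<s} (\<lambda>_. X))" by simp
  then have "\<not> PiE {..<s} (\<lambda>_. X) \<subseteq> \<Union>(bad ` prs)"
    using card_mono[of "\<Union>(bad ` prs)" "PiE {..<s} (\<lambda>_. X)"] finp finbad by auto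
  then obtain x where x: "x \<in> PiE {..<s} (\<lambda>_. X)" "x \<notin> \<Union>(bad ` prs)" by blast
  show ?thesis
  proof (intro exI[of _ "x ` {..<s}"] conjI)
    show "x ` {..<s} \<subseteq> X" using x by auto
    show "card (x ` {..<s}) \<le> s" using card_image_le[of "{..<s}" x] by simp
    show "inj_on (\<lambda>A. A \<inter> x ` {..<s}) W"
    proof (rule inj_onI, rule ccontr)
      fix A B assume AB: "A \<in> W" "B \<in> W" "A \<inter> x ` {..<s} = B \<inter> x ` {..<s}" "A \<noteq> B"
      have "x \<in> bad (A, B)"
        unfolding bad_def using x(1) AB(3) by (auto simp: PiE_iff)
      then show False using x(2) AB by (auto simp: prs_def)
    qed
  qed
qed

text \<open>
  Dudley's packing bound. About \<open>2 u ln M\<close> points, with \<open>u = card X / \<delta>\<close>, distinguish all \<open>M\<close> members, so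
  the Sauer-Shelah lemma bounds \<open>M\<close> by a \<open>D\<close>-th power of a multiple of \<open>u (1 + ln M / D)\<close>. The logarithm is
  absorbed by giving up half of the exponent, which is why \<open>2 * D\<close> rather than \<open>D\<close> appears. The bound
  depends on \<open>X\<close> only through the ratio \<open>u\<close>, and this makes the chaining sum below converge.
\<close>

lemma card_packing_le:
  assumes X: "finite X" "W \<subseteq> Pow X"
    and D: "1 \<le> D" "\<And>S. shatters W S \<Longrightarrow> S \<subseteq> X \<Longrightarrow> card S \<le> D"
    and \<delta>: "0 < \<delta>" "\<delta> \<le> real (card X)"
    and sep: "\<And>A B. A \<in> W \<Longrightarrow> B \<in> W \<Longrightarrow> A \<noteq> B \<Longrightarrow> \<delta> \<le> real (card (sym_diff A B))"
  shows "real (card W) \<le> (4 * exp 1 * (real (card X) / \<delta>)) ^ (2 * D)"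
proof (cases "card W = 0")
  case False
  define n where "n = real (card X)"
  define u where "u = n / \<delta>"
  define M where "M = real (card W)"
  have n: "0 < n" using \<delta> by (simp add: n_def)
  have u: "1 \<le> u" using \<delta> by (simp add: u_def n_def)
  have M: "1 \<le> M" using False by (simp add: M_def)
  define s where "s = D + nat \<lfloor>2 * u * ln M\<rfloor> + 1"
  have lnM: "0 \<le> 2 * u * ln M" using u M by auto
  \<comment> \<open>The summand \<open>D\<close> in \<open>s\<close> secures \<open>D \<le> s\<close>, which the bound on binomial sums requires.\<close>
  have s_gt: "2 * u * ln M < real s" unfolding s_def using lnM by linarith
  have s_le: "real s \<le> 2 * real D + 2 * u * ln M" unfolding s_def using lnM D(1) by linarith
  have "\<exists>S\<subseteq>X. card S \<le> s \<and> inj_on (\<lambda>A. A \<inter> S) W"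
  proof (rule exists_distinguishing_subset[OF X _ sep])
    show "X \<noteq> {}" using \<delta> by auto
    have "(n - \<delta>) ^ s = n ^ s * (1 - 1 / u) ^ s"
      using n \<delta> by (simp add: u_def divide_simps flip: power_mult_distrib) (simp add: field_simps)
    also have "\<dots> \<le> n ^ s * exp (- 1 / u) ^ s"
      using n u exp_ge_add_one_self[of "-1 / u"] by (intro mult_left_mono power_mono) auto
    also have "exp (- 1 / u) ^ s = exp (- real s / u)"
      by (simp flip: exp_of_nat_mult)
    finally have "M\<^sup>2 * (n - \<delta>) ^ s \<le> M\<^sup>2 * (n ^ s * exp (- real s / u))"
      by (intro mult_left_mono) auto
    also have "\<dots> = n ^ s * exp (2 * ln M - real s / u)"
      using M unfolding exp_diff exp_double by (simp add: exp_minus field_simps)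
    also have "\<dots> < n ^ s * exp 0"
      using n u s_gt by (intro mult_strict_left_mono, subst exp_less_cancel_iff) (auto simp: field_simps)
    finally show "(real (card W))\<^sup>2 * (real (card X) - \<delta>) ^ s < real (card X) ^ s"
      by (simp add: M_def n_def)
  qed
  then obtain S where S: "S \<subseteq> X" "card S \<le> s" "inj_on (\<lambda>A. A \<inter> S) W" by blast
  have finS: "finite S" by (rule finite_subset[OF S(1) X(1)])
  have "card W = card ((\<lambda>A. A \<inter> S) ` W)" using S(3) by (simp add: card_image)
  also have "\<dots> \<le> (\<Sum>i\<le>D. card S choose i)"
    using finS by (rule sauer_shelah) (use D(2) S(1) shatters_trace in \<open>blast+\<close>)
  also have "\<dots> \<le> (\<Sum>i\<le>D. s choose i)"
    by (intro sum_mono binomial_right_mono S)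
  finally have "M \<le> real (\<Sum>i\<le>D. s choose i)" unfolding M_def by (simp del: of_nat_sum)
  also have "\<dots> \<le> (exp 1 * real s / real D) ^ D"
    by (rule sum_binomial_le_power) (use D in \<open>auto simp: s_def\<close>)
  finally have M_le: "M \<le> (exp 1 * real s / real D) ^ D" .
  define L where "L = ln M / real D"
  have L: "0 \<le> L" using M by (simp add: L_def)
  have M_eq: "M = exp L ^ D" using M D(1) by (simp add: L_def flip: exp_of_nat_mult)
  \<comment> \<open>Take \<open>D\<close>-th roots and solve the resulting inequality for \<open>exp (L / 2)\<close>.\<close>
  have "exp L ^ D \<le> (exp 1 * real s / real D) ^ D" using M_le M_eq by simp
  then have "exp L \<le> exp 1 * real s / real D"
    using power_le_imp_le_base[of "exp L" "D - 1" "exp 1 * real s / real D"] D(1) by simp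
  also have "\<dots> = exp 1 * (real s / real D)" by simp
  also have "\<dots> \<le> exp 1 * (2 + 2 * u * L)"
    using s_le D(1) by (intro mult_left_mono) (auto simp: L_def field_simps)
  also have "\<dots> \<le> exp 1 * (2 * u * (1 + L))"
    using u L by (intro mult_left_mono) (auto simp: algebra_simps)
  also have "\<dots> \<le> exp 1 * (2 * u * (2 * exp (L / 2)))"
  proof -
    have "1 + L \<le> 2 * exp (L / 2)" using exp_ge_add_one_self[of "L / 2"] L by linarith
    then show ?thesis using u by (intro mult_left_mono) auto
  qed
  also have "\<dots> = 4 * exp 1 * u * exp (L / 2)" by simp
  finally have "exp (L / 2) * exp (L / 2) \<le> 4 * exp 1 * u * exp (L / 2)"
    by (simp flip: exp_add)
  then have half: "exp (L / 2) \<le> 4 * exp 1 * u" by simp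
  have "M = exp (L / 2) ^ (2 * D)"
    using exp_double[of "L / 2"] unfolding M_eq power_mult by simp
  also have "\<dots> \<le> (4 * exp 1 * u) ^ (2 * D)"
    using half by (intro power_mono) auto
  finally show ?thesis by (simp add: M_def u_def n_def)
qed simp

section \<open>Chaining for Rademacher sums\<close>

text \<open>
  Hoeffding's lemma for a fair sign: the case \<open>p = 1/2\<close>, \<open>h = 2 x\<close> of \<open>Hoeffdings_lemma_aux\<close>.
\<close>

lemma cosh_le_exp_half_square:
  fixes x :: real
  shows "exp (- x) + exp x \<le> 2 * exp (x\<^sup>2 / 2)"
proof -
  have *: "exp (- x) + exp x \<le> 2 * exp (x\<^sup>2 / 2)" if x: "0 \<le> x" for x :: real
  proof -
    have pos: "0 < 1 + 1/2 * (exp (2*x) - 1)"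
      using exp_gt_zero[of "2*x"] by (simp add: field_simps add_pos_pos)
    have "- (2*x) * (1/2) + ln (1 + 1/2 * (exp (2*x) - 1)) \<le> (2*x)\<^sup>2 / 8"
      using Hoeffdings_lemma_aux[of "2*x" "1/2"] x by simp
    then have "exp (- (2*x) * (1/2) + ln (1 + 1/2 * (exp (2*x) - 1))) \<le> exp ((2*x)\<^sup>2 / 8)"
      by simp
    then have "exp (- x) * (1 + 1/2 * (exp (2*x) - 1)) \<le> exp (x\<^sup>2 / 2)"
      unfolding exp_add exp_ln[OF pos] by (simp add: power_mult_distrib)
    moreover have "exp (- x) * (1 + 1/2 * (exp (2*x) - 1)) = (exp (- x) + exp x) / 2"
      by (simp add: algebra_simps flip: exp_add)
    ultimately show ?thesis by simp
  qed
  show ?thesis using *[of x] *[of "- x"] by (cases "0 \<le> x") (auto simp: add.commute)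
qed

text \<open>
  A set \<open>\<sigma>\<close> encodes a sign vector by the positions of its minus signs, so that probabilities over
  random signs become cardinalities of subsets of \<open>Pow I\<close> relative to \<open>2 ^ card I\<close>.
\<close>

definition rademacher_sum :: "'k set \<Rightarrow> 'k set \<Rightarrow> ('k \<Rightarrow> real) \<Rightarrow> real" where
  "rademacher_sum I \<sigma> a = (\<Sum>k\<in>I. (if k \<in> \<sigma> then - a k else a k))"

lemma rademacher_sum_minus: "rademacher_sum I \<sigma> (\<lambda>k. - a k) = - rademacher_sum I \<sigma> a"
  unfolding rademacher_sum_def sum_negf[symmetric] by (rule sum.cong) auto

lemma rademacher_sum_diff:
  "rademacher_sum I \<sigma> a - rademacher_sum I \<sigma> b = rademacher_sum I \<sigma> (\<lambda>k. a k - b k)"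
  unfolding rademacher_sum_def sum_subtractf[symmetric] by (rule sum.cong) auto

lemma sum_exp_rademacher_sum_le:
  assumes I: "finite I"
  shows "(\<Sum>\<sigma>\<in>Pow I. exp (l * rademacher_sum I \<sigma> a)) \<le> 2 ^ card I * exp (l\<^sup>2 * (\<Sum>k\<in>I. (a k)\<^sup>2) / 2)"
proof -
  have "exp (l * rademacher_sum I \<sigma> a) =
      (\<Prod>k\<in>\<sigma>. exp (- (l * a k))) * (\<Prod>k\<in>I - \<sigma>. exp (l * a k))" if "\<sigma> \<in> Pow I" for \<sigma>
  proof -
    have "exp (l * rademacher_sum I \<sigma> a) = (\<Prod>k\<in>I. if k \<in> \<sigma> then exp (- (l * a k)) else exp (l * a k))"
      unfolding rademacher_sum_def sum_distrib_left exp_sum[OF I] by (rule prod.cong) auto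
    also have "\<dots> = (\<Prod>k\<in>I \<inter> \<sigma>. exp (- (l * a k))) * (\<Prod>k\<in>I - \<sigma>. exp (l * a k))"
      using prod.If_cases[OF I, of "\<lambda>k. k \<in> \<sigma>"] by (simp add: Diff_eq Collect_neg_eq)
    also have "I \<inter> \<sigma> = \<sigma>" using that by auto
    finally show ?thesis .
  qed
  then have "(\<Sum>\<sigma>\<in>Pow I. exp (l * rademacher_sum I \<sigma> a)) =
      (\<Sum>\<sigma>\<in>Pow I. (\<Prod>k\<in>\<sigma>. exp (- (l * a k))) * (\<Prod>k\<in>I - \<sigma>. exp (l * a k)))"
    by (rule sum.cong[OF refl])
  also have "\<dots> = (\<Prod>k\<in>I. exp (- (l * a k)) + exp (l * a k))"
    by (rule prod_add[OF I, symmetric])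
  also have "\<dots> \<le> (\<Prod>k\<in>I. 2 * exp ((l * a k)\<^sup>2 / 2))"
    by (intro prod_mono conjI cosh_le_exp_half_square) (auto intro: add_nonneg_nonneg)
  also have "\<dots> = 2 ^ card I * exp (l\<^sup>2 * (\<Sum>k\<in>I. (a k)\<^sup>2) / 2)"
    by (simp add: prod.distrib I sum_distrib_left sum_divide_distrib power_mult_distrib flip: exp_sum)
  finally show ?thesis .
qed

lemma card_rademacher_sum_gt:
  assumes I: "finite I" and V: "(\<Sum>k\<in>I. (a k)\<^sup>2) \<le> V" "0 < V" and t: "0 \<le> t"
  shows "real (card {\<sigma>\<in>Pow I. t < rademacher_sum I \<sigma> a}) \<le> 2 ^ card I * exp (- (t\<^sup>2 / (2 * V)))"
proof -
  define l where "l = t / V"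
  have l: "0 \<le> l" using t V by (simp add: l_def)
  have "real (card {\<sigma>\<in>Pow I. t < rademacher_sum I \<sigma> a}) * exp (l * t) =
      (\<Sum>\<sigma>\<in>{\<sigma>\<in>Pow I. t < rademacher_sum I \<sigma> a}. exp (l * t))"
    by simp
  also have "\<dots> \<le> (\<Sum>\<sigma>\<in>{\<sigma>\<in>Pow I. t < rademacher_sum I \<sigma> a}. exp (l * rademacher_sum I \<sigma> a))"
    using l by (intro sum_mono) (auto intro: mult_left_mono)
  also have "\<dots> \<le> (\<Sum>\<sigma>\<in>Pow I. exp (l * rademacher_sum I \<sigma> a))"
    using I by (intro sum_mono2) auto
  also have "\<dots> \<le> 2 ^ card I * exp (l\<^sup>2 * (\<Sum>k\<in>I. (a k)\<^sup>2) / 2)"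
    by (rule sum_exp_rademacher_sum_le[OF I])
  also have "\<dots> \<le> 2 ^ card I * exp (l\<^sup>2 * V / 2)"
    using V by (intro mult_left_mono, subst exp_le_cancel_iff) (auto intro: divide_right_mono mult_left_mono)
  finally have "real (card {\<sigma>\<in>Pow I. t < rademacher_sum I \<sigma> a}) \<le> 2 ^ card I * exp (l\<^sup>2 * V / 2) / exp (l * t)"
    by (simp add: field_simps)
  also have "\<dots> = 2 ^ card I * exp (l\<^sup>2 * V / 2 - l * t)"
    by (simp add: exp_diff)
  also have "l\<^sup>2 * V / 2 - l * t = - (t\<^sup>2 / (2 * V))"
    using V by (simp add: l_def field_simps power2_eq_square)
  finally show ?thesis .
qed

lemma card_abs_rademacher_sum_gt:
  assumes I: "finite I" and V: "(\<Sum>k\<in>I. (a k)\<^sup>2) \<le> V" "0 < V" and t: "0 \<le> t"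
  shows "real (card {\<sigma>\<in>Pow I. t < \<bar>rademacher_sum I \<sigma> a\<bar>}) \<le> 2 ^ card I * (2 * exp (- (t\<^sup>2 / (2 * V))))"
proof -
  have "{\<sigma>\<in>Pow I. t < \<bar>rademacher_sum I \<sigma> a\<bar>} =
      {\<sigma>\<in>Pow I. t < rademacher_sum I \<sigma> a} \<union> {\<sigma>\<in>Pow I. t < rademacher_sum I \<sigma> (\<lambda>k. - a k)}"
    by (auto simp: rademacher_sum_minus)
  then have "card {\<sigma>\<in>Pow I. t < \<bar>rademacher_sum I \<sigma> a\<bar>} \<le>
      card {\<sigma>\<in>Pow I. t < rademacher_sum I \<sigma> a} + card {\<sigma>\<in>Pow I. t < rademacher_sum I \<sigma> (\<lambda>k. - a k)}"
    by (simp add: card_Un_le)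
  also have "real \<dots> \<le> 2 ^ card I * exp (- (t\<^sup>2 / (2 * V))) + 2 ^ card I * exp (- (t\<^sup>2 / (2 * V)))"
    unfolding of_nat_add using assms by (intro add_mono card_rademacher_sum_gt) auto
  finally show ?thesis by simp
qed

text \<open>
  The indices \<open>(k, True)\<close> and \<open>(k, False)\<close> stand for the \<open>k\<close>-th point of a sample and of its independent
  copy; exchanging the two flips the sign of \<open>pair_diff A k\<close>.
\<close>

definition pair_diff :: "('k \<times> bool) set \<Rightarrow> 'k \<Rightarrow> real" where
  "pair_diff A k = indicator A (k, True) - indicator A (k, False)"

lemma pair_diff_empty [simp]: "pair_diff {} k = 0"
  by (simp add: pair_diff_def)

text \<open>
  The variance of the difference of two Rademacher sums is controlled by the Hamming distance of the
  index sets. This is what makes a Hamming net suitable for chaining.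
\<close>

lemma sum_pair_diff_square_le:
  assumes I: "finite I" and AB: "A \<subseteq> I \<times> UNIV" "B \<subseteq> I \<times> UNIV"
  shows "(\<Sum>k\<in>I. (pair_diff A k - pair_diff B k)\<^sup>2) \<le> 2 * real (card (sym_diff A B))"
proof -
  let ?D = "sym_diff A B"
  have "(\<Sum>k\<in>I. (pair_diff A k - pair_diff B k)\<^sup>2) \<le>
      (\<Sum>k\<in>I. 2 * (\<Sum>b\<in>UNIV. indicator ?D (k, b)))"
    by (intro sum_mono) (auto simp: pair_diff_def UNIV_bool indicator_def power2_eq_square)
  also have "\<dots> = 2 * (\<Sum>x\<in>I \<times> UNIV. indicator ?D x)"
    by (simp add: sum.cartesian_product sum_distrib_left[symmetric])
  also have "(\<Sum>x\<in>I \<times> UNIV. indicator ?D x) = real (card ?D)"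
  proof -
    have "(I \<times> UNIV) \<inter> ?D = ?D" using AB by auto
    then show ?thesis
      using I sum.inter_restrict[of "I \<times> UNIV" "\<lambda>_. 1 :: real" ?D] by (simp add: indicator_def of_bool_def)
  qed
  finally show ?thesis .
qed

lemma maximal_packing_exists:
  assumes "finite V" "\<And>A. A \<in> V \<Longrightarrow> dst A A = (0::real)" "\<And>A B. dst A B = dst B A"
  shows "\<exists>W\<subseteq>V. (\<forall>A\<in>W. \<forall>B\<in>W. A \<noteq> B \<longrightarrow> \<delta> \<le> dst A B) \<and> (\<forall>A\<in>V - W. \<exists>B\<in>W. dst A B < \<delta>)"
proof -
  define PP where "PP = {W. W \<subseteq> V \<and> (\<forall>A\<in>W. \<forall>B\<in>W. A \<noteq> B \<longrightarrow> \<delta> \<le> dst A B)}"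
  have "finite PP" "PP \<noteq> {}" using assms(1) by (auto simp: PP_def)
  then obtain W where W: "W \<in> PP" "\<forall>U\<in>PP. W \<subseteq> U \<longrightarrow> W = U"
    using finite_has_maximal by metis
  have "\<exists>B\<in>W. dst A B < \<delta>" if "A \<in> V - W" for A
  proof (rule ccontr)
    assume neg: "\<not> ?thesis"
    have far: "\<delta> \<le> dst A B" "\<delta> \<le> dst B A" if "B \<in> W" for B
      using neg that assms(3)[of A B] by (force simp: not_less)+
    have "insert A W \<in> PP" unfolding PP_def
    proof (rule CollectI, intro conjI ballI impI)
      show "insert A W \<subseteq> V" using W(1) \<open>A \<in> V - W\<close> by (simp add: PP_def)
      fix C D assume "C \<in> insert A W" "D \<in> insert A W" "C \<noteq> D"
      then show "\<delta> \<le> dst C D" using far W(1) unfolding PP_def by (elim insertE) simp_all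
    qed
    then have "insert A W = W" using W(2) by blast
    then show False using \<open>A \<in> V - W\<close> by blast
  qed
  moreover have "W \<subseteq> V" "\<forall>A\<in>W. \<forall>B\<in>W. A \<noteq> B \<longrightarrow> \<delta> \<le> dst A B" using W(1) by (simp_all add: PP_def)
  ultimately show ?thesis by (intro exI[of _ W]) simp
qed

text \<open>
  A maximal \<open>\<delta>\<close>-separated subfamily is a net at scale \<open>\<delta>\<close>, and its size is bounded by the packing lemma. At
  the dyadic scale \<open>2 K / 2\<^sup>j\<close> its logarithm grows only linearly in \<open>j\<close>.
\<close>

lemma nets_exist:
  fixes I :: "'k set" and V :: "('k \<times> bool) set set"
  assumes I: "finite I" "I \<noteq> {}" and V: "V \<subseteq> Pow (I \<times> UNIV)"
    and D: "1 \<le> D" "\<And>S. shatters V S \<Longrightarrow> S \<subseteq> I \<times> UNIV \<Longrightarrow> card S \<le> D"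
  shows "\<exists>W\<subseteq>V. real (card W) \<le> exp (6 * real D * real (j + 1)) \<and>
    (\<forall>A\<in>V. \<exists>B\<in>W. real (card (sym_diff A B)) < 2 * real (card I) / 2 ^ j)"
proof -
  define \<delta> where "\<delta> = 2 * real (card I) / 2 ^ j"
  have K: "1 \<le> real (card I)" using I by (simp add: Suc_le_eq card_gt_0_iff)
  have \<delta>: "0 < \<delta>" "\<delta> \<le> 2 * real (card I)" using K by (auto simp: \<delta>_def divide_simps)
  have finV: "finite V" using V I by (meson finite_Pow_iff finite_SigmaI finite_subset finite)
  obtain W where W: "W \<subseteq> V"
      "\<And>A B. A \<in> W \<Longrightarrow> B \<in> W \<Longrightarrow> A \<noteq> B \<Longrightarrow> \<delta> \<le> real (card (sym_diff A B))"
      "\<And>A. A \<in> V - W \<Longrightarrow> \<exists>B\<in>W. real (card (sym_diff A B)) < \<delta>"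
    using maximal_packing_exists[OF finV, of "\<lambda>A B. real (card (sym_diff A B))" \<delta>]
    by (auto simp: Un_commute)
  have cIU: "real (card (I \<times> (UNIV :: bool set))) = 2 * real (card I)"
    by (simp add: card_cartesian_product)
  have "real (card W) \<le> (4 * exp 1 * (real (card (I \<times> (UNIV :: bool set))) / \<delta>)) ^ (2 * D)"
  proof (rule card_packing_le[OF _ _ D(1) _ \<delta>(1) _ W(2)])
    show "finite (I \<times> (UNIV :: bool set))" using I by simp
    show "W \<subseteq> Pow (I \<times> UNIV)" using W V by auto
    show "\<delta> \<le> real (card (I \<times> (UNIV :: bool set)))" using \<delta> cIU by simp
    show "card S \<le> D" if "shatters W S" "S \<subseteq> I \<times> UNIV" for S
      using that D(2) W(1) unfolding shatters_def by (meson image_mono order_trans)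
  qed
  also have "real (card (I \<times> (UNIV :: bool set))) / \<delta> = 2 ^ j"
    unfolding cIU \<delta>_def using K by simp
  also have "(4 * exp 1 * 2 ^ j) ^ (2 * D) \<le> (exp (3 * real (j + 1))) ^ (2 * D)"
  proof (rule power_mono)
    have e: "(2 :: real) \<le> exp 1" using exp_ge_add_one_self[of 1] by simp
    have "(4 :: real) * exp 1 \<le> exp 1 * exp 1 * exp 1"
      using mult_mono[OF e e] by (intro mult_right_mono) auto
    moreover have "(2 :: real) ^ j \<le> exp 1 ^ j" using e by (intro power_mono) auto
    ultimately have "4 * exp 1 * 2 ^ j \<le> (exp 1 * exp 1 * exp 1) * (exp 1 ^ j :: real)"
      by (intro mult_mono) auto
    also have "\<dots> = exp (3 + real j)" by (simp add: exp_add flip: exp_of_nat_mult) (simp flip: exp_add)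
    also have "\<dots> \<le> exp (3 * real (j + 1))" by simp
    finally show "4 * exp 1 * 2 ^ j \<le> exp (3 * real (j + 1))" .
  qed auto
  also have "\<dots> = exp (6 * real D * real (j + 1))"
    by (simp add: algebra_simps flip: exp_of_nat_mult)
  finally have "real (card W) \<le> exp (6 * real D * real (j + 1))" .
  moreover have "\<exists>B\<in>W. real (card (sym_diff A B)) < \<delta>" if "A \<in> V" for A
    using W(3)[of A] that \<delta>(1) by (cases "A \<in> W") (auto intro!: bexI[of _ A])
  ultimately show ?thesis using W(1) unfolding \<delta>_def by blast
qed

lemma card_link_le:
  fixes A B :: "('k \<times> bool) set"
  assumes I: "finite I" and AB: "A \<subseteq> I \<times> UNIV" "B \<subseteq> I \<times> UNIV"
    and d: "real (card (sym_diff A B)) \<le> \<delta>" "0 < \<delta>" and t: "0 \<le> t"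
  shows "real (card {\<sigma>\<in>Pow I. t < \<bar>rademacher_sum I \<sigma> (pair_diff A) - rademacher_sum I \<sigma> (pair_diff B)\<bar>})
    \<le> 2 ^ card I * (2 * exp (- (t\<^sup>2 / (4 * \<delta>))))"
proof -
  have "(\<Sum>k\<in>I. (pair_diff A k - pair_diff B k)\<^sup>2) \<le> 2 * \<delta>"
    using sum_pair_diff_square_le[OF I AB] d(1) by linarith
  from card_abs_rademacher_sum_gt[OF I this _ t] d(2) show ?thesis
    by (simp add: rademacher_sum_diff)
qed

lemma sum_power_le:
  fixes q :: real
  assumes "0 \<le> q" "q < 1"
  shows "(\<Sum>i\<le>n. q ^ i) \<le> 1 / (1 - q)"
proof -
  have "(1 - q) * (\<Sum>i\<le>n. q ^ i) \<le> 1"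
    unfolding sum_gp_basic using assms by simp
  then show ?thesis using assms by (simp add: field_simps)
qed

text \<open>
  Chaining. Each set of the net at level \<open>j\<close> is linked to a set of the net at level \<open>j - 1\<close> within the scale of that net; the
  bottom level is linked to the empty set, whose sum vanishes. Along a link the sum has variance
  proxy of order \<open>K / 2\<^sup>j\<close>, so allowing it the deviation \<open>t j = (\<tau> K / 4) (3/4)\<^sup>j\<close> gives an exponent of order
  \<open>\<tau>\<^sup>2 K (9/8)\<^sup>j\<close>. This beats the entropy \<open>6 D (j + 1)\<close> of the net as soon as \<open>\<tau>\<^sup>2 K\<close> exceeds a multiple of \<open>D\<close>, on every
  level at once and with no logarithmic factor, while the deviations \<open>t j\<close> still add up to at most \<open>\<tau> K\<close>.
\<close>

lemma rademacher_chaining: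
  fixes I :: "'k set" and V :: "('k \<times> bool) set set"
  assumes I: "finite I" "I \<noteq> {}" and V: "V \<subseteq> Pow (I \<times> UNIV)"
    and D: "1 \<le> D" "\<And>S. shatters V S \<Longrightarrow> S \<subseteq> I \<times> UNIV \<Longrightarrow> card S \<le> D"
    and \<tau>: "0 < \<tau>" "24576 * real D \<le> \<tau>\<^sup>2 * real (card I)"
  shows "real (card {\<sigma>\<in>Pow I. \<exists>A\<in>V. \<tau> * real (card I) < \<bar>rademacher_sum I \<sigma> (pair_diff A)\<bar>})
    \<le> 2 ^ card I * (4 * exp (- (\<tau>\<^sup>2 * real (card I) / 4096)))"
proof -
  define K where "K = real (card I)"
  have K: "1 \<le> K" using I by (simp add: K_def Suc_le_eq card_gt_0_iff)
  have finV: "finite V" using V I by (meson finite_Pow_iff finite_SigmaI finite_subset finite)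
  define \<Phi> where "\<Phi> = (\<lambda>\<sigma> A. rademacher_sum I \<sigma> (pair_diff A))"
  define t where "t = (\<lambda>j. \<tau> * K / 4 * (3/4) ^ j)"
  define q where "q = exp (- (\<tau>\<^sup>2 * K / 4096))"
  have t0: "0 \<le> t j" for j using \<tau> K by (simp add: t_def)
  have "\<forall>j. \<exists>W\<subseteq>V. real (card W) \<le> exp (6 * real D * real (j + 1)) \<and>
    (\<forall>A\<in>V. \<exists>B\<in>W. real (card (sym_diff A B)) < 2 * real (card I) / 2 ^ j)"
    using nets_exist[OF I V D] by blast
  then obtain W where W: "\<And>j. W j \<subseteq> V" "\<And>j. real (card (W j)) \<le> exp (6 * real D * real (j + 1))"
     "\<And>j A. A \<in> V \<Longrightarrow> \<exists>B\<in>W j. real (card (sym_diff A B)) < 2 * K / 2 ^ j"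
    unfolding K_def by metis
  define near where
    "near = (\<lambda>j A. SOME B. B \<in> W j \<and> real (card (sym_diff A B)) < 2 * K / 2 ^ j)"
  have near: "near j A \<in> W j" "real (card (sym_diff A (near j A))) < 2 * K / 2 ^ j"
    if "A \<in> V" for j A
    using someI_ex[OF W(3)[OF that, of j, unfolded Bex_def]] by (simp_all add: near_def)
  define parent where "parent = (\<lambda>j A. case j of 0 \<Rightarrow> {} | Suc i \<Rightarrow> near i A)"
  define bad where "bad = (\<lambda>j. {\<sigma>\<in>Pow I. \<exists>A\<in>W j. t j < \<bar>\<Phi> \<sigma> A - \<Phi> \<sigma> (parent j A)\<bar>})"
  have \<Phi>0: "\<Phi> \<sigma> {} = 0" for \<sigma> by (simp add: \<Phi>_def rademacher_sum_def cong: if_cong)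
  have q: "0 < q" "q \<le> 1/2"
  proof -
    have "1 \<le> \<tau>\<^sup>2 * K / 4096" using \<tau>(2) D(1) by (simp add: K_def)
    then have "2 \<le> exp (\<tau>\<^sup>2 * K / 4096)" using exp_ge_add_one_self[of "\<tau>\<^sup>2 * K / 4096"] by linarith
    then show "q \<le> 1/2" unfolding q_def exp_minus by (simp add: field_simps)
  qed (simp add: q_def)
  have bad_le: "real (card (bad j)) \<le> 2 ^ card I * (2 * q ^ (j + 1))" for j
  proof -
    have link: "real (card {\<sigma>\<in>Pow I. t j < \<bar>\<Phi> \<sigma> A - \<Phi> \<sigma> (parent j A)\<bar>})
        \<le> 2 ^ card I * (2 * exp (- ((t j)\<^sup>2 / (4 * (4 * K / 2 ^ j)))))" if A: "A \<in> W j" for A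
      unfolding \<Phi>_def
    proof (rule card_link_le[OF I(1) _ _ _ _ t0])
      have AV: "A \<in> V" using A W by auto
      show "A \<subseteq> I \<times> UNIV" using AV V by auto
      show "parent j A \<subseteq> I \<times> UNIV"
      proof (cases j)
        case (Suc i)
        have "near i A \<in> Pow (I \<times> UNIV)" using near(1)[OF AV, of i] W(1)[of i] V by (meson subsetD)
        then show ?thesis by (simp add: parent_def Suc)
      qed (simp add: parent_def)
      show "0 < 4 * K / 2 ^ j" using K by simp
      show "real (card (sym_diff A (parent j A))) \<le> 4 * K / 2 ^ j"
      proof (cases j)
        case 0
        have "card A \<le> card (I \<times> (UNIV :: bool set))" using AV V I by (intro card_mono) auto
        then show ?thesis using K 0 by (simp add: parent_def K_def card_cartesian_product)
      next
        case (Suc i)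
        then show ?thesis using near(2)[OF AV, of i] by (simp add: parent_def)
      qed
    qed
    have "(t j)\<^sup>2 / (4 * (4 * K / 2 ^ j)) = \<tau>\<^sup>2 * K / 256 * (9/8) ^ j"
    proof -
      have "((3/4 :: real) ^ j)\<^sup>2 * 2 ^ j = (9/8) ^ j"
        by (simp add: power2_eq_square flip: power_mult_distrib)
      then show ?thesis using K unfolding t_def
        by (simp add: power_mult_distrib power_divide field_simps power2_eq_square)
    qed
    also have "\<dots> \<ge> \<tau>\<^sup>2 * K / 256 * (real (j + 1) / 8)"
    proof (rule mult_left_mono)
      have "1 + real j * (1/8) \<le> (1 + 1/8 :: real) ^ j" by (rule Bernoulli_inequality) auto
      moreover have "(1 + 1/8 :: real) = 9/8" by simp
      ultimately have "1 + real j * (1/8) \<le> (9/8 :: real) ^ j" by (simp only:)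
      then show "real (j + 1) / 8 \<le> (9/8) ^ j" by simp
    qed (use K in auto)
    finally have expo: "\<tau>\<^sup>2 * K / 2048 * real (j + 1) \<le> (t j)\<^sup>2 / (4 * (4 * K / 2 ^ j))" by simp
    have badU: "bad j = (\<Union>A\<in>W j. {\<sigma>\<in>Pow I. t j < \<bar>\<Phi> \<sigma> A - \<Phi> \<sigma> (parent j A)\<bar>})"
      by (auto simp: bad_def)
    have "card (bad j) \<le> (\<Sum>A\<in>W j. card {\<sigma>\<in>Pow I. t j < \<bar>\<Phi> \<sigma> A - \<Phi> \<sigma> (parent j A)\<bar>})"
      unfolding badU by (rule card_UN_le[OF finite_subset[OF W(1) finV]])
    then have "real (card (bad j)) \<le> (\<Sum>A\<in>W j. real (card {\<sigma>\<in>Pow I. t j < \<bar>\<Phi> \<sigma> A - \<Phi> \<sigma> (parent j A)\<bar>}))"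
      by (simp flip: of_nat_sum)
    also have "\<dots> \<le> (\<Sum>A\<in>W j. 2 ^ card I * (2 * exp (- ((t j)\<^sup>2 / (4 * (4 * K / 2 ^ j))))))"
      by (intro sum_mono link)
    also have "\<dots> = real (card (W j)) * (2 ^ card I * (2 * exp (- ((t j)\<^sup>2 / (4 * (4 * K / 2 ^ j))))))"
      by simp
    also have "\<dots> \<le> exp (6 * real D * real (j + 1)) *
        (2 ^ card I * (2 * exp (- (\<tau>\<^sup>2 * K / 2048 * real (j + 1)))))"
      using expo by (intro mult_mono W(2) mult_left_mono) auto
    also have "\<dots> = 2 ^ card I * (2 * exp ((6 * real D - \<tau>\<^sup>2 * K / 2048) * real (j + 1)))"
      by (simp add: algebra_simps flip: exp_add)
    also have "\<dots> \<le> 2 ^ card I * (2 * exp (- (\<tau>\<^sup>2 * K / 4096) * real (j + 1)))"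
      using \<tau>(2) by (intro mult_left_mono, subst exp_le_cancel_iff, intro mult_right_mono)
        (auto simp: K_def)
    also have "exp (- (\<tau>\<^sup>2 * K / 4096) * real (j + 1)) = q ^ (j + 1)"
      unfolding q_def exp_of_nat_mult[symmetric] by (simp add: mult.commute)
    finally show ?thesis .
  qed
  \<comment> \<open>From this level on the scale is below \<open>1\<close>, so the net is the whole family.\<close>
  obtain J where J: "2 * K < 2 ^ J" using real_arch_pow[of 2 "2 * K"] by auto
  have good: "\<bar>\<Phi> \<sigma> A\<bar> \<le> (\<Sum>i\<le>j. t i)"
    if "\<sigma> \<in> Pow I" "\<And>i. i \<le> j \<Longrightarrow> \<sigma> \<notin> bad i" "A \<in> W j" for \<sigma> A j
    using that(2,3)
  proof (induction j arbitrary: A)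
    case 0
    then show ?case using that(1) \<Phi>0[of \<sigma>] by (force simp: bad_def parent_def not_less)
  next
    case (Suc j)
    have "A \<in> V" using Suc.prems W by auto
    then have "\<bar>\<Phi> \<sigma> (near j A)\<bar> \<le> (\<Sum>i\<le>j. t i)"
      using Suc.prems(1) near(1) by (intro Suc.IH) auto
    moreover have "\<bar>\<Phi> \<sigma> A - \<Phi> \<sigma> (near j A)\<bar> \<le> t (Suc j)"
      using Suc.prems(1)[of "Suc j"] Suc.prems(2) that(1) by (auto simp: bad_def parent_def not_less)
    ultimately show ?case by simp
  qed
  have sum_t: "(\<Sum>i\<le>j. t i) \<le> \<tau> * K" for j
  proof -
    have "(\<Sum>i\<le>j. (3/4 :: real) ^ i) \<le> 4"
      using sum_power_le[of "3/4" j] by simp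
    then have "\<tau> * K / 4 * (\<Sum>i\<le>j. (3/4) ^ i) \<le> \<tau> * K / 4 * 4"
      using \<tau> K by (intro mult_left_mono) auto
    then show ?thesis by (simp add: t_def sum_distrib_left)
  qed
  have VJ: "V \<subseteq> W J"
  proof
    fix A assume A: "A \<in> V"
    have "2 * K / 2 ^ J < 1" using J by simp
    then have "real (card (A - near J A \<union> (near J A - A))) < 1" using near(2)[OF A, of J] by linarith
    moreover have "finite (A - near J A \<union> (near J A - A))"
      using A near(1)[OF A] W(1) V I by (meson Diff_subset Pow_iff finite_SigmaI finite finite_subset finite_Un finite_Diff subsetD)
    ultimately have "A = near J A" by auto
    then show "A \<in> W J" using near(1)[OF A] by metis
  qed
  have "{\<sigma>\<in>Pow I. \<exists>A\<in>V. \<tau> * K < \<bar>\<Phi> \<sigma> A\<bar>} \<subseteq> (\<Union>j\<in>{..J}. bad j)"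
  proof (rule subsetI, rule ccontr)
    fix \<sigma> assume \<sigma>: "\<sigma> \<in> {\<sigma>\<in>Pow I. \<exists>A\<in>V. \<tau> * K < \<bar>\<Phi> \<sigma> A\<bar>}" "\<sigma> \<notin> (\<Union>j\<in>{..J}. bad j)"
    then obtain A where A: "A \<in> V" "\<tau> * K < \<bar>\<Phi> \<sigma> A\<bar>" by auto
    then show False using good[of \<sigma> J A] \<sigma> VJ sum_t[of J] by fastforce
  qed
  then have "card {\<sigma>\<in>Pow I. \<exists>A\<in>V. \<tau> * K < \<bar>\<Phi> \<sigma> A\<bar>} \<le> card (\<Union>j\<in>{..J}. bad j)"
    using I by (intro card_mono) (auto simp: bad_def)
  also have "\<dots> \<le> (\<Sum>j\<le>J. card (bad j))" by (rule card_UN_le) simp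
  also have "real \<dots> \<le> (\<Sum>j\<le>J. 2 ^ card I * (2 * q ^ (j + 1)))"
    unfolding of_nat_sum by (intro sum_mono bad_le)
  also have "\<dots> = 2 ^ card I * (2 * q * (\<Sum>j\<le>J. q ^ j))"
    by (simp add: sum_distrib_left mult_ac)
  also have "\<dots> \<le> 2 ^ card I * (2 * q * 2)"
  proof -
    have "(\<Sum>j\<le>J. q ^ j) \<le> 1 / (1 - q)" using q by (intro sum_power_le) auto
    also have "\<dots> \<le> 2" using q by (simp add: field_simps)
    finally show ?thesis using q by (intro mult_left_mono) auto
  qed
  finally show ?thesis by (simp add: q_def K_def \<Phi>_def)
qed

section \<open>Symmetrization\<close>

text \<open>
  Passing to the traces of \<open>H\<close> on the sample points \<open>x\<close> does not enlarge shattered sets: coinciding sample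
  points cannot be separated, so a shattered index set is mapped injectively to a shattered point set.
\<close>

lemma shatters_vimage:
  fixes x :: "'l \<Rightarrow> 's"
  assumes sh: "shatters ((\<lambda>h. {l\<in>L. x l \<in> h}) ` H) T" and T: "T \<subseteq> L"
  shows "inj_on x T" "shatters H (x ` T)"
proof -
  show inj: "inj_on x T"
  proof (rule inj_onI)
    fix a b assume ab: "a \<in> T" "b \<in> T" "x a = x b"
    then obtain h where h: "{a} = {l\<in>L. x l \<in> h} \<inter> T"
      using shattersD[OF sh, of "{a}"] by auto
    then have "a \<in> {l\<in>L. x l \<in> h} \<inter> T" by (metis singletonI)
    then have "b \<in> {l\<in>L. x l \<in> h} \<inter> T" using ab T by auto
    then show "a = b" unfolding h[symmetric] by simp
  qed
  show "shatters H (x ` T)"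
  proof (rule shattersI)
    fix U assume U: "U \<subseteq> x ` T"
    obtain h where h: "h \<in> H" "{l\<in>T. x l \<in> U} = {l\<in>L. x l \<in> h} \<inter> T"
      using shattersD[OF sh, of "{l\<in>T. x l \<in> U}"] by auto
    have "U = h \<inter> x ` T"
    proof (rule equalityI; rule subsetI)
      fix s assume "s \<in> U"
      then obtain l where "l \<in> T" "s = x l" using U by auto
      then show "s \<in> h \<inter> x ` T" using h(2) \<open>s \<in> U\<close> by blast
    next
      fix s assume "s \<in> h \<inter> x ` T"
      then obtain l where "l \<in> T" "s = x l" "x l \<in> h" by auto
      then show "s \<in> U" using h(2) T by blast
    qed
    then show "\<exists>A\<in>H. U = A \<inter> x ` T" using h(1) by blast
  qed
qed

text \<open>
  A sample of independent points \<open>Z k\<close>, each with its own law, and a ghost sample: both live on the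
  product over \<open>I \<times> UNIV\<close> of the marginal laws, where each law occurs twice.
\<close>

locale doubled_sample = prob_space M for M :: "'a measure" +
  fixes S :: "'s measure" and Z :: "'k \<Rightarrow> 'a \<Rightarrow> 's" and I :: "'k set"
  assumes indep: "indep_vars (\<lambda>_. S) Z I" and I: "finite I" "I \<noteq> {}"
begin

text \<open>
  The point mass outside \<open>I\<close> makes \<open>law\<close> a probability measure on \<open>S\<close> at every index, as \<open>product_sigma_finite\<close>
  demands.
\<close>

definition law :: "'k \<times> bool \<Rightarrow> 's measure" where
  "law l = (if fst l \<in> I then distr M S (Z (fst l)) else return S (SOME s. s \<in> space S))"

lemma rv_Z: "k \<in> I \<Longrightarrow> random_variable S (Z k)"
  using indep by (auto simp: indep_vars_def)

lemma space_S_ne: "space S \<noteq> {}"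
proof -
  obtain k where "k \<in> I" using I(2) by auto
  obtain \<omega> where "\<omega> \<in> space M" using not_empty by auto
  then have "Z k \<omega> \<in> space S" by (rule measurable_space[OF rv_Z[OF \<open>k \<in> I\<close>]])
  then show ?thesis by auto
qed

lemma prob_space_law: "prob_space (law l)"
  using prob_space_distr[OF rv_Z] prob_space_return[of "SOME s. s \<in> space S" S] space_S_ne
  by (auto simp: law_def some_in_eq)

lemma sets_law [measurable_cong]: "sets (law l) = sets S"
  by (simp add: law_def)

lemma space_law: "space (law l) = space S"
  by (simp add: law_def)

sublocale product_sigma_finite law
  by (simp add: product_sigma_finite_def prob_space_imp_sigma_finite prob_space_law)

text \<open>
  Independence says that the joint law of the \<open>Z k\<close> is a product, and restricting the doubled sample to
  the indices \<open>(k, b)\<close> with \<open>b\<close> fixed yields the same product.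
\<close>

lemma emeasure_half:
  assumes J: "(\<lambda>k. (k, b)) ` I \<subseteq> J" and Pr: "Measurable.pred (PiM I (\<lambda>_. S)) Pr"
  shows "emeasure (PiM J law) {x\<in>space (PiM J law). Pr (\<lambda>k\<in>I. x (k, b))} =
    emeasure M {\<omega>\<in>space M. Pr (\<lambda>k\<in>I. Z k \<omega>)}"
proof -
  let ?P = "PiM I (\<lambda>k. law (k, b))"
  have sets_P: "sets ?P = sets (PiM I (\<lambda>_. S))"
    by (rule sets_PiM_cong) (simp_all add: sets_law)
  then have space_P: "space ?P = space (PiM I (\<lambda>_. S))" by (rule sets_eq_imp_space_eq)
  have "distr M (PiM I (\<lambda>_. S)) (\<lambda>\<omega>. \<lambda>k\<in>I. Z k \<omega>) = PiM I (\<lambda>k. distr M S (Z k))"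
    using indep indep_vars_iff_distr_eq_PiM'[OF I(2), where M' = "\<lambda>_. S" and X = Z] rv_Z by auto
  also have "\<dots> = ?P" by (rule PiM_cong) (simp_all add: law_def)
  finally have 1: "distr M (PiM I (\<lambda>_. S)) (\<lambda>\<omega>. \<lambda>k\<in>I. Z k \<omega>) = ?P" .
  have 2: "distr (PiM J law) ?P (\<lambda>x. \<lambda>k\<in>I. x (k, b)) = ?P"
    using J by (intro distr_PiM_reindex prob_space_law) (auto simp: inj_on_def)
  have Pr': "{y\<in>space ?P. Pr y} \<in> sets ?P"
    using Pr unfolding space_P sets_P by (simp add: pred_def)
  have m2: "(\<lambda>x. \<lambda>k\<in>I. x (k, b)) \<in> measurable (PiM J law) ?P"
    using J by (intro measurable_restrict measurable_component_singleton) auto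
  have m1: "(\<lambda>\<omega>. \<lambda>k\<in>I. Z k \<omega>) \<in> measurable M (PiM I (\<lambda>_. S))"
    by (intro measurable_restrict rv_Z)
  have "emeasure ?P {y\<in>space ?P. Pr y} = emeasure (PiM J law) {x\<in>space (PiM J law). Pr (\<lambda>k\<in>I. x (k, b))}"
    using emeasure_distr[OF m2 Pr'] measurable_space[OF m2] unfolding 2
    by (auto intro!: arg_cong2[where f=emeasure])
  moreover have "emeasure ?P {y\<in>space ?P. Pr y} = emeasure M {\<omega>\<in>space M. Pr (\<lambda>k\<in>I. Z k \<omega>)}"
    using emeasure_distr[OF m1, of "{y\<in>space ?P. Pr y}"] measurable_space[OF m1] Pr'
    unfolding 1 sets_P[symmetric] space_P
    by (auto intro!: arg_cong2[where f=emeasure])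
  ultimately show ?thesis by simp
qed

definition expected_count :: "'s set \<Rightarrow> real" where
  "expected_count h = (\<Sum>k\<in>I. prob {\<omega>\<in>space M. Z k \<omega> \<in> h})"

definition count_in :: "'s set \<Rightarrow> ('k \<Rightarrow> 's) \<Rightarrow> real" where
  "count_in h y = (\<Sum>k\<in>I. indicator h (y k))"

lemma count_in_restrict [simp]: "count_in h (\<lambda>k\<in>I. y k) = count_in h y"
  by (simp add: count_in_def)

lemma measurable_count_in:
  assumes "h \<in> sets S" "\<And>k. k \<in> I \<Longrightarrow> (\<lambda>x. y x k) \<in> measurable N S"
  shows "(\<lambda>x. count_in h (y x)) \<in> borel_measurable N"
  unfolding count_in_def
  by (intro borel_measurable_sum measurable_compose[OF assms(2)] borel_measurable_indicator assms(1))

lemma hoeffding_count: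
  assumes h: "h \<in> sets S" and \<tau>: "0 < \<tau>" "1 \<le> \<tau>\<^sup>2 * real (card I)"
  shows "1/2 \<le> prob {\<omega>\<in>space M. \<bar>count_in h (\<lambda>k. Z k \<omega>) - expected_count h\<bar> < \<tau> * real (card I)}"
proof -
  have mset: "{\<omega>\<in>space M. Z k \<omega> \<in> h} \<in> events" if "k \<in> I" for k
    using measurable_sets[OF rv_Z[OF that] h] by (simp add: vimage_def Int_def conj_commute)
  interpret H: Hoeffding_ineq M I "\<lambda>k \<omega>. indicator h (Z k \<omega>) :: real" "\<lambda>_. 0" "\<lambda>_. 1" "expected_count h"
  proof unfold_locales
    show "indep_vars (\<lambda>_. borel) (\<lambda>k \<omega>. indicator h (Z k \<omega>) :: real) I"
      by (rule indep_vars_compose2[OF indep]) (use h in simp)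
    have "expected_count h = (\<Sum>k\<in>I. expectation (\<lambda>\<omega>. indicator h (Z k \<omega>)))"
      unfolding expected_count_def
    proof (rule sum.cong[OF refl])
      fix k assume k: "k \<in> I"
      have "expectation (\<lambda>\<omega>. indicator h (Z k \<omega>)) =
          expectation (\<lambda>\<omega>. indicator {\<omega>\<in>space M. Z k \<omega> \<in> h} \<omega> :: real)"
        by (rule Bochner_Integration.integral_cong) (auto simp: indicator_def)
      also have "\<dots> = prob {\<omega>\<in>space M. Z k \<omega> \<in> h}"
        using mset[OF k] by simp
      finally show "prob {\<omega>\<in>space M. Z k \<omega> \<in> h} = expectation (\<lambda>\<omega>. indicator h (Z k \<omega>))" ..
    qed
    then show "expected_count h \<equiv> (\<Sum>k\<in>I. expectation (\<lambda>\<omega>. indicator h (Z k \<omega>)))"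
      by (rule eq_reflection)
  qed (auto simp: I indicator_def)
  let ?K = "real (card I)"
  have K: "0 < ?K" using I by (simp add: card_gt_0_iff)
  have "prob {\<omega>\<in>space M. \<tau> * ?K \<le> \<bar>(\<Sum>k\<in>I. indicator h (Z k \<omega>)) - expected_count h\<bar>}
      \<le> 2 * exp (- 2 * (\<tau> * ?K)\<^sup>2 / ?K)"
    using H.Hoeffding_ineq_abs_ge[of "\<tau> * ?K"] \<tau> K by simp
  also have "- 2 * (\<tau> * ?K)\<^sup>2 / ?K = - (2 * (\<tau>\<^sup>2 * ?K))" using K by (simp add: power2_eq_square)
  also have "2 * exp (- (2 * (\<tau>\<^sup>2 * ?K))) \<le> 2 * exp (- 2)" using \<tau> by simp
  also have "\<dots> \<le> 1/2"
  proof -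
    have "(2 :: real) \<le> exp 1" using exp_ge_add_one_self[of 1] by simp
    then have "2 * 2 \<le> exp 1 * (exp 1 :: real)" by (intro mult_mono) auto
    then have "4 \<le> (exp 2 :: real)" by (simp flip: exp_add)
    then show ?thesis by (simp add: exp_minus field_simps)
  qed
  finally have far: "prob {\<omega>\<in>space M. \<tau> * ?K \<le> \<bar>count_in h (\<lambda>k. Z k \<omega>) - expected_count h\<bar>} \<le> 1/2"
    by (simp add: count_in_def)
  have [measurable]: "(\<lambda>\<omega>. count_in h (\<lambda>k. Z k \<omega>)) \<in> borel_measurable M"
    by (rule measurable_count_in[OF h rv_Z])
  have "prob {\<omega>\<in>space M. \<not> \<tau> * ?K \<le> \<bar>count_in h (\<lambda>k. Z k \<omega>) - expected_count h\<bar>} =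
      1 - prob {\<omega>\<in>space M. \<tau> * ?K \<le> \<bar>count_in h (\<lambda>k. Z k \<omega>) - expected_count h\<bar>}"
    by (rule prob_neg) measurable
  then show ?thesis using far by (simp add: not_le)
qed

text \<open>
  Exchanging \<open>(k, True)\<close> with \<open>(k, False)\<close> for the \<open>k\<close> in \<open>\<sigma>\<close> permutes coordinates of equal law and hence
  preserves the product measure. Averaging over all \<open>\<sigma>\<close> bounds the probability by the largest
  proportion, over fixed \<open>2 K\<close> points, of sign vectors with a large Rademacher sum; chaining bounds that
  proportion. Countability of \<open>H\<close> is what makes the event measurable.
\<close>

lemma swap_bound:
  fixes H :: "'s set set"
  assumes H: "countable H" "H \<subseteq> sets S"
    and D: "1 \<le> D" "\<And>T. finite T \<Longrightarrow> shatters H T \<Longrightarrow> T \<subseteq> space S \<Longrightarrow> card T \<le> D"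
    and \<tau>: "0 < \<tau>" "24576 * real D \<le> \<tau>\<^sup>2 * real (card I)"
  defines "P \<equiv> PiM (I \<times> UNIV) law"
  shows "measure P {x\<in>space P. \<exists>h\<in>H. \<tau> * real (card I) <
      \<bar>count_in h (\<lambda>k. x (k, True)) - count_in h (\<lambda>k. x (k, False))\<bar>}
    \<le> 4 * exp (- (\<tau>\<^sup>2 * real (card I) / 4096))"
proof -
  let ?L = "I \<times> (UNIV :: bool set)"
  let ?c = "4 * exp (- (\<tau>\<^sup>2 * real (card I) / 4096))"
  interpret P: prob_space P unfolding P_def by (rule prob_space_PiM prob_space_law)+
  define dev where "dev = (\<lambda>h x. count_in h (\<lambda>k. x (k, True)) - count_in h (\<lambda>k. x (k, False)))"
  define A where "A = {x\<in>space P. \<exists>h\<in>H. \<tau> * real (card I) < \<bar>dev h x\<bar>}"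
  define swap where "swap = (\<lambda>\<sigma> x. \<lambda>l\<in>?L. x (fst l, snd l \<noteq> (fst l \<in> \<sigma>)) :: 's)"
  have comp: "(\<lambda>x. x l) \<in> measurable P S" if "l \<in> ?L" for l
    using measurable_component_singleton[OF that, of law] unfolding P_def
    by (simp cong: measurable_cong_sets add: sets_law)
  have dev_meas: "dev h \<in> borel_measurable P" if "h \<in> H" for h
    unfolding dev_def using that H(2)
    by (intro borel_measurable_diff measurable_count_in comp) auto
  have A: "A \<in> sets P"
  proof -
    have "A = (\<Union>h\<in>H. {x\<in>space P. \<tau> * real (card I) < \<bar>dev h x\<bar>})" by (auto simp: A_def)
    also have "\<dots> \<in> sets P"
      using dev_meas by (intro sets.countable_UN'[OF H(1)] borel_measurable_less) auto
    finally show ?thesis .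
  qed
  have swap_meas: "swap \<sigma> \<in> measurable P P" for \<sigma>
    unfolding swap_def P_def
  proof (rule measurable_restrict)
    fix l :: "'k \<times> bool" assume "l \<in> ?L"
    then have "(fst l, snd l \<noteq> (fst l \<in> \<sigma>)) \<in> ?L" by auto
    from measurable_component_singleton[OF this, of law]
    show "(\<lambda>x. x (fst l, snd l \<noteq> (fst l \<in> \<sigma>))) \<in> measurable (PiM ?L law) (law l)"
      by (simp add: law_def cong: if_cong)
  qed
  have swap_inv: "distr P P (swap \<sigma>) = P" for \<sigma>
  proof -
    let ?f = "\<lambda>l. (fst l, snd l \<noteq> (fst l \<in> \<sigma>))"
    have "law (?f l) = law l" for l by (simp add: law_def)
    moreover have "distr (PiM ?L law) (\<Pi>\<^sub>M l\<in>?L. law (?f l)) (\<lambda>x. \<lambda>l\<in>?L. x (?f l)) = (\<Pi>\<^sub>M l\<in>?L. law (?f l))"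
      by (intro distr_PiM_reindex prob_space_law) (auto simp: inj_on_def)
    ultimately show ?thesis unfolding P_def swap_def by simp
  qed
  have dev_swap: "dev h (swap \<sigma> x) = rademacher_sum I \<sigma> (pair_diff {l\<in>?L. x l \<in> h})" for h \<sigma> x
    unfolding dev_def count_in_def swap_def rademacher_sum_def sum_subtractf[symmetric]
    by (rule sum.cong) (auto simp: pair_diff_def indicator_def)
  have pointwise: "(\<Sum>\<sigma>\<in>Pow I. indicator A (swap \<sigma> x)) \<le> 2 ^ card I * ?c" if x: "x \<in> space P" for x
  proof -
    let ?V = "(\<lambda>h. {l\<in>?L. x l \<in> h}) ` H"
    have "(\<Sum>\<sigma>\<in>Pow I. indicator A (swap \<sigma> x)) = real (card {\<sigma>\<in>Pow I. swap \<sigma> x \<in> A})"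
    proof -
      have "(\<Sum>\<sigma>\<in>Pow I. indicator A (swap \<sigma> x)) = (\<Sum>\<sigma>\<in>Pow I. if swap \<sigma> x \<in> A then 1 else 0 :: real)"
        by (rule sum.cong[OF refl]) (simp add: indicator_def)
      also have "\<dots> = (\<Sum>\<sigma>\<in>{\<sigma>\<in>Pow I. swap \<sigma> x \<in> A}. 1)"
        by (rule sum.inter_filter[symmetric]) (simp add: I(1))
      finally show ?thesis by simp
    qed
    also have "{\<sigma>\<in>Pow I. swap \<sigma> x \<in> A} =
        {\<sigma>\<in>Pow I. \<exists>B\<in>?V. \<tau> * real (card I) < \<bar>rademacher_sum I \<sigma> (pair_diff B)\<bar>}"
      using measurable_space[OF swap_meas x] by (auto simp: A_def dev_swap)
    also have "real (card \<dots>) \<le> 2 ^ card I * ?c"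
    proof (rule rademacher_chaining[OF I _ D(1) _ \<tau>])
      show "?V \<subseteq> Pow ?L" by auto
      fix T assume T: "shatters ?V T" "T \<subseteq> ?L"
      have "finite T" using T(2) I(1) finite_subset by fastforce
      moreover have "x ` T \<subseteq> space S"
        using x T(2) by (auto simp: P_def space_PiM PiE_iff space_law)
      ultimately have "card (x ` T) \<le> D"
        using shatters_vimage(2)[OF T] by (intro D(2)) auto
      then show "card T \<le> D" using shatters_vimage(1)[OF T] by (simp add: card_image)
    qed
    finally show ?thesis .
  qed
  have int: "integrable P (\<lambda>x. indicator A (swap \<sigma> x) :: real)" for \<sigma>
  proof (rule P.integrable_const_bound[of _ 1])
    have "indicator A \<in> borel_measurable P" using A by simp
    then show "(\<lambda>x. indicator A (swap \<sigma> x) :: real) \<in> borel_measurable P"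
      by (rule measurable_compose[OF swap_meas])
  qed (simp add: indicator_def)
  have eq: "measure P A = (\<integral>x. indicator A (swap \<sigma> x) \<partial>P)" for \<sigma>
  proof -
    have "(\<integral>x. indicator A (swap \<sigma> x) \<partial>P) = (\<integral>x. (indicator A x :: real) \<partial>distr P P (swap \<sigma>))"
      by (rule integral_distr[symmetric, OF swap_meas]) (use A in simp)
    then show ?thesis using A by (simp add: swap_inv)
  qed
  have "2 ^ card I * measure P A = (\<Sum>\<sigma>\<in>Pow I. \<integral>x. indicator A (swap \<sigma> x) \<partial>P)"
    using I by (simp add: eq[symmetric] card_Pow)
  also have "\<dots> = (\<integral>x. (\<Sum>\<sigma>\<in>Pow I. indicator A (swap \<sigma> x)) \<partial>P)"
    by (rule Bochner_Integration.integral_sum[symmetric]) (rule int)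
  also have "\<dots> \<le> 2 ^ card I * ?c"
    by (rule P.integral_le_const) (use pointwise int in auto)
  finally show ?thesis by (simp add: A_def dev_def)
qed

text \<open>
  If the first half deviates by more than \<open>2 \<tau> K\<close> on some \<open>h\<close>, then, by Hoeffding's inequality for this one
  \<open>h\<close>, the second half stays within \<open>\<tau> K\<close> of the expectation with probability at least \<open>1/2\<close>, and the two
  halves differ by more than \<open>\<tau> K\<close>. Integrating over the first half gives the factor \<open>2\<close>.
\<close>

lemma symmetrization:
  fixes H :: "'s set set"
  assumes H: "countable H" "H \<subseteq> sets S" and \<tau>: "0 < \<tau>" "1 \<le> \<tau>\<^sup>2 * real (card I)"
  defines "P \<equiv> PiM (I \<times> UNIV) law"
  shows "prob {\<omega>\<in>space M. \<exists>h\<in>H. 2 * \<tau> * real (card I) < \<bar>count_in h (\<lambda>k. Z k \<omega>) - expected_count h\<bar>}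
    \<le> 2 * measure P {x\<in>space P. \<exists>h\<in>H. \<tau> * real (card I) <
      \<bar>count_in h (\<lambda>k. x (k, True)) - count_in h (\<lambda>k. x (k, False))\<bar>}"
proof -
  let ?K = "real (card I)"
  let ?T = "I \<times> {True}" and ?F = "I \<times> {False}"
  define far where "far = (\<lambda>y. \<exists>h\<in>H. 2 * \<tau> * ?K < \<bar>count_in h y - expected_count h\<bar>)"
  define A where "A = {x\<in>space P. \<exists>h\<in>H. \<tau> * ?K <
      \<bar>count_in h (\<lambda>k. x (k, True)) - count_in h (\<lambda>k. x (k, False))\<bar>}"
  define B where "B = {x\<in>space P. far (\<lambda>k. x (k, True))}"
  have far_restrict: "far (\<lambda>k\<in>I. y k) = far y" for y by (simp add: far_def)
  interpret P: prob_space P unfolding P_def by (rule prob_space_PiM prob_space_law)+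
  interpret F: prob_space "PiM ?F law" by (rule prob_space_PiM prob_space_law)+
  have comp: "(\<lambda>x. x l) \<in> measurable P S" if "l \<in> I \<times> UNIV" for l
    using measurable_component_singleton[OF that, of law] unfolding P_def
    by (simp cong: measurable_cong_sets add: sets_law)
  have A: "A \<in> sets P"
  proof -
    have "A = (\<Union>h\<in>H. {x\<in>space P. \<tau> * ?K <
        \<bar>count_in h (\<lambda>k. x (k, True)) - count_in h (\<lambda>k. x (k, False))\<bar>})" by (auto simp: A_def)
    also have "\<dots> \<in> sets P"
      using H(2) by (intro sets.countable_UN'[OF H(1)] borel_measurable_less borel_measurable_const
        borel_measurable_abs borel_measurable_diff measurable_count_in comp image_subsetI) auto
    finally show ?thesis .
  qed
  have far_meas: "{x\<in>space N. far (y x)} \<in> sets N" if "\<And>k. k \<in> I \<Longrightarrow> (\<lambda>x. y x k) \<in> measurable N S" for N y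
  proof -
    have "{x\<in>space N. far (y x)} = (\<Union>h\<in>H. {x\<in>space N. 2 * \<tau> * ?K < \<bar>count_in h (y x) - expected_count h\<bar>})"
      by (auto simp: far_def)
    also have "\<dots> \<in> sets N"
      using H(2) that by (intro sets.countable_UN'[OF H(1)] borel_measurable_less borel_measurable_const
        borel_measurable_abs borel_measurable_diff measurable_count_in image_subsetI) auto
    finally show ?thesis .
  qed
  have B: "B \<in> sets P" unfolding B_def by (rule far_meas) (use comp in auto)
  have LTF: "I \<times> UNIV = ?T \<union> ?F" by (auto simp: UNIV_bool)
  have merge: "merge ?T ?F (u, w) (k, True) = u (k, True)"
      "merge ?T ?F (u, w) (k, False) = w (k, False)" if "k \<in> I" for u w k
    using that by (auto simp: merge_def)
  have count_merge: "count_in h (\<lambda>k. merge ?T ?F (u, w) (k, True)) = count_in h (\<lambda>k. u (k, True))"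
      "count_in h (\<lambda>k. merge ?T ?F (u, w) (k, False)) = count_in h (\<lambda>k. w (k, False))" for h u w
    unfolding count_in_def by (simp_all add: merge)
  have half: "ennreal (1/2) \<le> emeasure (PiM ?F law)
      {w\<in>space (PiM ?F law). \<bar>count_in h (\<lambda>k. w (k, False)) - expected_count h\<bar> < \<tau> * ?K}"
    if h: "h \<in> H" for h
  proof -
    have hS: "h \<in> sets S" using h H(2) by auto
    have "emeasure (PiM ?F law) {w\<in>space (PiM ?F law).
          \<bar>count_in h (\<lambda>k\<in>I. w (k, False)) - expected_count h\<bar> < \<tau> * ?K} =
        emeasure M {\<omega>\<in>space M. \<bar>count_in h (\<lambda>k\<in>I. Z k \<omega>) - expected_count h\<bar> < \<tau> * ?K}"
    proof (rule emeasure_half)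
      have [measurable]: "count_in h \<in> borel_measurable (PiM I (\<lambda>_. S))"
        by (rule measurable_count_in[OF hS, where y = "\<lambda>y. y"]) (rule measurable_component_singleton)
      show "Measurable.pred (PiM I (\<lambda>_. S)) (\<lambda>y. \<bar>count_in h y - expected_count h\<bar> < \<tau> * ?K)"
        by measurable
    qed auto
    then show ?thesis
      using ennreal_leI[OF hoeffding_count[OF hS \<tau>]] unfolding count_in_restrict emeasure_eq_measure
      by (simp only:)
  qed
  have inner: "(\<integral>\<^sup>+w. indicator B (merge ?T ?F (u, w)) \<partial>PiM ?F law) \<le>
      2 * (\<integral>\<^sup>+w. indicator A (merge ?T ?F (u, w)) \<partial>PiM ?F law)" if u: "u \<in> space (PiM ?T law)" for u
  proof (cases "far (\<lambda>k. u (k, True))")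
    case False
    then have "indicator B (merge ?T ?F (u, w)) = (0 :: ennreal)" for w
      by (auto simp: B_def far_def count_merge)
    then show ?thesis by simp
  next
    case True
    then obtain h where h: "h \<in> H" "2 * \<tau> * ?K < \<bar>count_in h (\<lambda>k. u (k, True)) - expected_count h\<bar>"
      by (auto simp: far_def)
    let ?N = "{w\<in>space (PiM ?F law). \<bar>count_in h (\<lambda>k. w (k, False)) - expected_count h\<bar> < \<tau> * ?K}"
    have "merge ?T ?F (u, w) \<in> A" if "w \<in> ?N" for w
    proof -
      have "merge ?T ?F (u, w) \<in> space P"
        using u that measurable_space[OF measurable_merge[of ?T ?F law], of "(u, w)"]
        unfolding P_def LTF by (simp add: space_pair_measure)
      moreover have "\<tau> * ?K < \<bar>count_in h (\<lambda>k. u (k, True)) - count_in h (\<lambda>k. w (k, False))\<bar>"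
        using that h(2) by auto
      ultimately show ?thesis using h(1) by (auto simp: A_def count_merge)
    qed
    then have "(\<integral>\<^sup>+w. indicator ?N w \<partial>PiM ?F law) \<le> (\<integral>\<^sup>+w. indicator A (merge ?T ?F (u, w)) \<partial>PiM ?F law)"
      by (intro nn_integral_mono) (auto simp: indicator_def)
    moreover have "?N \<in> sets (PiM ?F law)"
    proof -
      have "(\<lambda>w. w (k, False)) \<in> measurable (PiM ?F law) S" if "k \<in> I" for k
        using measurable_component_singleton[of "(k, False)" ?F law] that
        by (simp cong: measurable_cong_sets add: sets_law)
      then have [measurable]: "(\<lambda>w. count_in h (\<lambda>k. w (k, False))) \<in> borel_measurable (PiM ?F law)"
        using h(1) H(2) by (intro measurable_count_in) auto
      show ?thesis by measurable
    qed
    ultimately have "ennreal (1/2) \<le> (\<integral>\<^sup>+w. indicator A (merge ?T ?F (u, w)) \<partial>PiM ?F law)"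
      using half[OF h(1)] by simp
    then have "2 * ennreal (1/2) \<le> 2 * (\<integral>\<^sup>+w. indicator A (merge ?T ?F (u, w)) \<partial>PiM ?F law)"
      by (rule mult_left_mono) simp
    moreover have "2 * ennreal (1/2) = 1"
      using ennreal_mult[of 2 "1/2"] by simp
    moreover have "(\<integral>\<^sup>+w. indicator B (merge ?T ?F (u, w)) \<partial>PiM ?F law) \<le> (\<integral>\<^sup>+w. 1 \<partial>PiM ?F law)"
      by (intro nn_integral_mono) (auto simp: indicator_def)
    ultimately show ?thesis by (simp add: F.emeasure_space_1)
  qed
  have fold: "emeasure P C = (\<integral>\<^sup>+u. \<integral>\<^sup>+w. indicator C (merge ?T ?F (u, w)) \<partial>PiM ?F law \<partial>PiM ?T law)"
    if "C \<in> sets P" for C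
  proof -
    have "emeasure P C = (\<integral>\<^sup>+x. indicator C x \<partial>PiM (?T \<union> ?F) law)"
      using that by (simp add: P_def LTF)
    also have "\<dots> = (\<integral>\<^sup>+u. \<integral>\<^sup>+w. indicator C (merge ?T ?F (u, w)) \<partial>PiM ?F law \<partial>PiM ?T law)"
      by (rule product_nn_integral_fold) (use I that in \<open>auto simp: P_def LTF\<close>)
    finally show ?thesis .
  qed
  have "emeasure P B \<le> (\<integral>\<^sup>+u. 2 * \<integral>\<^sup>+w. indicator A (merge ?T ?F (u, w)) \<partial>PiM ?F law \<partial>PiM ?T law)"
    unfolding fold[OF B] by (intro nn_integral_mono inner)
  also have "\<dots> = 2 * emeasure P A"
    unfolding fold[OF A]
  proof (rule nn_integral_cmult)
    have "(\<lambda>(u, w). indicator A (merge ?T ?F (u, w)) :: ennreal) \<in>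
        borel_measurable (PiM ?T law \<Otimes>\<^sub>M PiM ?F law)"
      using measurable_compose[OF measurable_merge[of ?T ?F law], of "indicator A :: _ \<Rightarrow> ennreal" borel] A
      unfolding P_def LTF by (simp add: case_prod_unfold)
    then show "(\<lambda>u. \<integral>\<^sup>+w. indicator A (merge ?T ?F (u, w)) \<partial>PiM ?F law) \<in> borel_measurable (PiM ?T law)"
      by (rule F.borel_measurable_nn_integral)
  qed
  finally have "emeasure P B \<le> 2 * emeasure P A" .
  then have le: "measure P B \<le> 2 * measure P A"
    by (simp add: P.emeasure_eq_measure ennreal_mult[symmetric] flip: ennreal_numeral)
  have "emeasure P {x\<in>space P. far (\<lambda>k\<in>I. x (k, True))} = emeasure M {\<omega>\<in>space M. far (\<lambda>k\<in>I. Z k \<omega>)}"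
    unfolding P_def
  proof (rule emeasure_half)
    show "Measurable.pred (PiM I (\<lambda>_. S)) far"
      unfolding pred_def by (rule far_meas) (rule measurable_component_singleton)
  qed auto
  then have "prob {\<omega>\<in>space M. far (\<lambda>k. Z k \<omega>)} = measure P B"
    by (simp add: far_restrict B_def measure_def)
  then show ?thesis using le by (simp add: far_def A_def)
qed

text \<open>
  The uniform law of large numbers for a Vapnik-Chervonenkis class of dimension \<open>D\<close> at the optimal
  sample size: of order \<open>D / \<tau>\<^sup>2\<close>, without a logarithm.
\<close>

theorem uniform_deviation:
  fixes H :: "'s set set"
  assumes H: "countable H" "H \<subseteq> sets S"
    and D: "1 \<le> D" "\<And>T. finite T \<Longrightarrow> shatters H T \<Longrightarrow> T \<subseteq> space S \<Longrightarrow> card T \<le> D"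
    and \<tau>: "0 < \<tau>" "24576 * real D \<le> \<tau>\<^sup>2 * real (card I)"
  shows "prob {\<omega>\<in>space M. \<exists>h\<in>H. 2 * \<tau> * real (card I) < \<bar>count_in h (\<lambda>k. Z k \<omega>) - expected_count h\<bar>}
    \<le> 8 * exp (- (\<tau>\<^sup>2 * real (card I) / 4096))"
proof -
  have "1 \<le> \<tau>\<^sup>2 * real (card I)" using \<tau>(2) D(1) by linarith
  from symmetrization[OF H \<tau>(1) this] swap_bound[OF H D \<tau>] show ?thesis by linarith
qed

end

section \<open>Half-spaces\<close>

text \<open>
  Elimination: pivoting on an unknown \<open>s\<close> that occurs in the last equation removes one unknown together
  with one equation.
\<close>

lemma linear_dependence:
  fixes f :: "nat \<Rightarrow> 't \<Rightarrow> real"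
  assumes "finite T" "n < card T"
  shows "\<exists>l. (\<exists>t\<in>T. l t \<noteq> 0) \<and> (\<forall>i<n. (\<Sum>t\<in>T. l t * f i t) = 0)"
  using assms
proof (induction n arbitrary: T f)
  case 0
  then have "T \<noteq> {}" by auto
  then show ?case by (intro exI[of _ "\<lambda>_. 1"]) auto
next
  case (Suc n)
  show ?case
  proof (cases "\<forall>t\<in>T. f n t = 0")
    case True
    obtain l where l: "\<exists>t\<in>T. l t \<noteq> 0" "\<forall>i<n. (\<Sum>t\<in>T. l t * f i t) = 0"
      using Suc.IH[of T f] Suc.prems by auto
    have "(\<Sum>t\<in>T. l t * f i t) = 0" if "i < Suc n" for i
      using that l(2) True by (cases "i = n") (auto simp: less_Suc_eq)
    then show ?thesis using l(1) by blast
  next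
    case False
    then obtain s where s: "s \<in> T" "f n s \<noteq> 0" by auto
    define g where "g = (\<lambda>i t. f i t - f i s * f n t / f n s)"
    have "n < card (T - {s})" using Suc.prems s by simp
    then obtain l where l: "\<exists>t\<in>T - {s}. l t \<noteq> 0" "\<And>i. i < n \<Longrightarrow> (\<Sum>t\<in>T - {s}. l t * g i t) = 0"
      using Suc.IH[of "T - {s}" g] Suc.prems by auto
    define c where "c = (\<Sum>t\<in>T - {s}. l t * f n t) / f n s"
    define l' where "l' = l(s := - c)"
    have *: "(\<Sum>t\<in>T. l' t * f i t) = (\<Sum>t\<in>T - {s}. l t * g i t)" for i
    proof -
      have "(\<Sum>t\<in>T. l' t * f i t) = - c * f i s + (\<Sum>t\<in>T - {s}. l' t * f i t)"
        using sum.remove[OF Suc.prems(1) s(1), of "\<lambda>t. l' t * f i t"] by (simp add: l'_def)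
      also have "(\<Sum>t\<in>T - {s}. l' t * f i t) = (\<Sum>t\<in>T - {s}. l t * f i t)"
        by (rule sum.cong) (auto simp: l'_def)
      also have "- c * f i s = - (\<Sum>t\<in>T - {s}. l t * (f i s * f n t / f n s))"
        by (simp add: c_def sum_distrib_left sum_distrib_right sum_divide_distrib mult_ac)
      finally show ?thesis
        by (simp add: g_def right_diff_distrib sum_subtractf)
    qed
    have "(\<Sum>t\<in>T. l' t * f i t) = 0" if "i < Suc n" for i
    proof (cases "i = n")
      case True
      then show ?thesis unfolding * using s(2) by (simp add: g_def)
    next
      case False
      then show ?thesis unfolding * using that l(2) by simp
    qed
    moreover have "\<exists>t\<in>T. l' t \<noteq> 0" using l(1) by (auto simp: l'_def)
    ultimately show ?thesis by blast
  qed
qed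

text \<open>
  Points of \<open>\<real>\<^sup>d\<close> are extensional functions on \<open>{..<d}\<close>, the elements of the product space of \<open>d\<close> copies of \<open>\<real>\<close>.
\<close>

definition halfspace :: "nat \<Rightarrow> (nat \<Rightarrow> real) \<Rightarrow> real \<Rightarrow> (nat \<Rightarrow> real) set" where
  "halfspace d a r = {x\<in>PiE {..<d} (\<lambda>_. UNIV). r \<le> (\<Sum>j<d. a j * x j)}"

text \<open>
  Radon's argument. More than \<open>d + 1\<close> points carry a nontrivial affine dependence \<open>l\<close>. A half-space that picks
  out exactly the points with \<open>l t \<ge> 0\<close> would make every summand of \<open>\<Sum>t. l t * (\<langle>a, t\<rangle> - r)\<close> nonnegative
  and one of them positive, although the sum vanishes.
\<close>

lemma halfspace_shatters_card_le:
  assumes H: "H \<subseteq> range (\<lambda>(a, r). halfspace d a r)" and T: "finite T" "shatters H T"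
    "T \<subseteq> PiE {..<d} (\<lambda>_. UNIV)"
  shows "card T \<le> d + 1"
proof (rule ccontr)
  assume "\<not> card T \<le> d + 1"
  then have "d + 1 < card T" by simp
  from linear_dependence[OF T(1) this, of "\<lambda>i t. if i < d then t i else 1"]
  obtain l where l: "\<exists>t\<in>T. l t \<noteq> 0"
     "\<And>i. i < d + 1 \<Longrightarrow> (\<Sum>t\<in>T. l t * (if i < d then t i else 1)) = 0" by blast
  have l_coord: "(\<Sum>t\<in>T. l t * t i) = 0" if "i < d" for i using l(2)[of i] that by simp
  have l_sum: "(\<Sum>t\<in>T. l t) = 0" using l(2)[of d] by simp
  obtain t0 where t0: "t0 \<in> T" "l t0 < 0"
  proof (rule ccontr)
    assume "\<not> thesis"
    then have "\<forall>t\<in>T. 0 \<le> l t" using that by (meson not_le)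
    then have "\<forall>t\<in>T. l t = 0" using l_sum sum_nonneg_eq_0_iff[OF T(1), of l] by auto
    then show False using l(1) by blast
  qed
  obtain h where h: "h \<in> H" "{t\<in>T. 0 \<le> l t} = h \<inter> T"
    using shattersD[OF T(2), of "{t\<in>T. 0 \<le> l t}"] by auto
  obtain a r where ar: "h = halfspace d a r" using h(1) H by auto
  have sep: "r \<le> (\<Sum>j<d. a j * t j) \<longleftrightarrow> 0 \<le> l t" if "t \<in> T" for t
  proof -
    have "t \<in> h \<longleftrightarrow> 0 \<le> l t" using h(2) that by blast
    then show ?thesis using that T(3) by (auto simp: ar halfspace_def)
  qed
  have "(\<Sum>t\<in>T. l t * ((\<Sum>j<d. a j * t j) - r)) =
      (\<Sum>t\<in>T. \<Sum>j<d. a j * (l t * t j)) - (\<Sum>t\<in>T. l t) * r"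
    by (simp add: right_diff_distrib sum_subtractf sum_distrib_left sum_distrib_right mult_ac)
  also have "(\<Sum>t\<in>T. \<Sum>j<d. a j * (l t * t j)) = (\<Sum>j<d. a j * (\<Sum>t\<in>T. l t * t j))"
    by (subst sum.swap) (simp add: sum_distrib_left)
  also have "\<dots> = 0" using l_coord by simp
  finally have zero: "(\<Sum>t\<in>T. l t * ((\<Sum>j<d. a j * t j) - r)) = 0" using l_sum by simp
  have nonneg: "0 \<le> l t * ((\<Sum>j<d. a j * t j) - r)" if "t \<in> T" for t
    using sep[OF that] by (cases "0 \<le> l t") (auto intro: mult_nonneg_nonneg mult_nonpos_nonpos)
  have "0 < l t0 * ((\<Sum>j<d. a j * t0 j) - r)"
    using sep[OF t0(1)] t0(2) by (intro mult_neg_neg) auto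
  then have "0 < (\<Sum>t\<in>T. l t * ((\<Sum>j<d. a j * t j) - r))"
    using t0(1) nonneg T(1) by (intro sum_pos2) auto
  then show False using zero by simp
qed

definition rational_halfspaces :: "nat \<Rightarrow> (nat \<Rightarrow> real) set set" where
  "rational_halfspaces d = (\<lambda>(a, r). halfspace d a r) ` (PiE {..<d} (\<lambda>_. \<rat>) \<times> \<rat>)"

lemma countable_rational_halfspaces: "countable (rational_halfspaces d)"
  unfolding rational_halfspaces_def
  by (intro countable_image countable_SIGMA countable_PiE countable_rat) auto

text \<open>
  The indicator of a closed half-space is a pointwise limit of indicators of rational ones. Points on
  the bounding hyperplane are the delicate ones: they are kept inside by approximating the normal
  vector to precision \<open>\<delta>\<^sup>2\<close> while lowering the threshold by the much larger amount \<open>\<delta>\<close>.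
\<close>

lemma halfspace_approximation:
  "\<exists>h. (\<forall>n. h n \<in> rational_halfspaces d) \<and>
    (\<forall>x\<in>PiE {..<d} (\<lambda>_. UNIV). \<forall>\<^sub>F n in sequentially. x \<in> h n \<longleftrightarrow> x \<in> halfspace d a r)"
proof -
  define \<delta> where "\<delta> = (\<lambda>n :: nat. 1 / real (Suc n))"
  have \<delta>: "0 < \<delta> n" for n by (simp add: \<delta>_def)
  have \<delta>_lim: "\<delta> \<longlonglongrightarrow> 0" unfolding \<delta>_def by (rule LIMSEQ_Suc[OF lim_1_over_n])
  have "\<forall>n j. \<exists>q. q \<in> \<rat> \<and> a j < q \<and> q < a j + (\<delta> n)\<^sup>2"
  proof (intro allI)
    fix n j
    show "\<exists>q. q \<in> \<rat> \<and> a j < q \<and> q < a j + (\<delta> n)\<^sup>2"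
      using Rats_dense_in_real[of "a j" "a j + (\<delta> n)\<^sup>2"] \<delta>[of n] by (auto simp: Bex_def)
  qed
  then obtain b where b: "\<And>n j. b n j \<in> \<rat>" "\<And>n j. a j < b n j" "\<And>n j. b n j < a j + (\<delta> n)\<^sup>2"
    by metis
  have "\<forall>n. \<exists>q. q \<in> \<rat> \<and> r - 2 * \<delta> n < q \<and> q < r - \<delta> n"
  proof
    fix n
    show "\<exists>q. q \<in> \<rat> \<and> r - 2 * \<delta> n < q \<and> q < r - \<delta> n"
      using Rats_dense_in_real[of "r - 2 * \<delta> n" "r - \<delta> n"] \<delta>[of n] by (auto simp: Bex_def)
  qed
  then obtain s where s: "\<And>n. s n \<in> \<rat>" "\<And>n. r - 2 * \<delta> n < s n" "\<And>n. s n < r - \<delta> n"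
    by metis
  define h where "h = (\<lambda>n. halfspace d (\<lambda>j\<in>{..<d}. b n j) (s n))"
  have "h n \<in> rational_halfspaces d" for n
    unfolding h_def rational_halfspaces_def using b(1) s(1)
    by (intro image_eqI[of _ _ "(\<lambda>j\<in>{..<d}. b n j, s n)"]) auto
  moreover have "\<forall>\<^sub>F n in sequentially. x \<in> h n \<longleftrightarrow> x \<in> halfspace d a r"
    if x: "x \<in> PiE {..<d} (\<lambda>_. UNIV)" for x
  proof -
    define L where "L = (\<Sum>j<d. \<bar>x j\<bar>)"
    define v where "v = (\<Sum>j<d. a j * x j)"
    have mem: "x \<in> h n \<longleftrightarrow> s n \<le> (\<Sum>j<d. b n j * x j)" for n
      using x by (simp add: h_def halfspace_def)
    have near: "\<bar>(\<Sum>j<d. b n j * x j) - v\<bar> \<le> (\<delta> n)\<^sup>2 * L" for n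
    proof -
      have "\<bar>(\<Sum>j<d. b n j * x j) - v\<bar> = \<bar>\<Sum>j<d. (b n j - a j) * x j\<bar>"
        by (simp add: v_def left_diff_distrib sum_subtractf)
      also have "\<dots> \<le> (\<Sum>j<d. \<bar>(b n j - a j) * x j\<bar>)" by (rule sum_abs)
      also have "\<dots> \<le> (\<Sum>j<d. (\<delta> n)\<^sup>2 * \<bar>x j\<bar>)"
      proof (rule sum_mono)
        fix j
        have "\<bar>b n j - a j\<bar> \<le> (\<delta> n)\<^sup>2" using b(2)[of j n] b(3)[of n j] by linarith
        then show "\<bar>(b n j - a j) * x j\<bar> \<le> (\<delta> n)\<^sup>2 * \<bar>x j\<bar>"
          unfolding abs_mult by (intro mult_right_mono) auto
      qed
      finally show ?thesis by (simp add: L_def sum_distrib_left)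
    qed
    have lim1: "(\<lambda>n. \<delta> n * L) \<longlonglongrightarrow> 0" using tendsto_mult_left_zero[OF \<delta>_lim] by simp
    have "(\<lambda>n. (\<delta> n)\<^sup>2 * L + 2 * \<delta> n) \<longlonglongrightarrow> 0\<^sup>2 * L + 2 * 0"
      by (intro tendsto_intros \<delta>_lim)
    then have lim2: "(\<lambda>n. (\<delta> n)\<^sup>2 * L + 2 * \<delta> n) \<longlonglongrightarrow> 0" by simp
    show ?thesis
    proof (cases "r \<le> v")
      case True
      have "\<forall>\<^sub>F n in sequentially. \<delta> n * L < 1"
        using order_tendstoD(2)[OF lim1, of 1] by simp
      then show ?thesis
      proof (eventually_elim)
        fix n assume "\<delta> n * L < 1"
        then have "(\<delta> n)\<^sup>2 * L \<le> \<delta> n * 1"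
          unfolding power2_eq_square mult.assoc using \<delta>[of n] by (intro mult_left_mono) auto
        then have "s n \<le> (\<Sum>j<d. b n j * x j)" using near[of n] s(3)[of n] True by linarith
        then show "x \<in> h n \<longleftrightarrow> x \<in> halfspace d a r"
          using True x by (simp add: mem halfspace_def v_def)
      qed
    next
      case False
      then have "\<forall>\<^sub>F n in sequentially. (\<delta> n)\<^sup>2 * L + 2 * \<delta> n < r - v"
        using order_tendstoD(2)[OF lim2, of "r - v"] by simp
      then show ?thesis
      proof (eventually_elim)
        fix n assume "(\<delta> n)\<^sup>2 * L + 2 * \<delta> n < r - v"
        then have "\<not> s n \<le> (\<Sum>j<d. b n j * x j)" using near[of n] s(2)[of n] by linarith
        then show "x \<in> h n \<longleftrightarrow> x \<in> halfspace d a r"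
          using False x by (simp add: mem halfspace_def v_def)
      qed
    qed
  qed
  ultimately show ?thesis by blast
qed

lemma sets_halfspace: "halfspace d a r \<in> sets (PiM {..<d} (\<lambda>_. borel))"
proof -
  have "{x\<in>space (PiM {..<d} (\<lambda>_. borel :: real measure)). r \<le> (\<Sum>j<d. a j * x j)} \<in>
      sets (PiM {..<d} (\<lambda>_. borel))"
    by measurable
  then show ?thesis by (simp add: halfspace_def space_PiM)
qed

text \<open>
  The exceptional event only involves countably many half-spaces and is therefore measurable; the
  bound extends to all closed half-spaces because counts and probabilities both pass to the limit.
\<close>

lemma (in prob_space) halfspace_uniform_deviation:
  fixes Z :: "'k \<Rightarrow> 'a \<Rightarrow> nat \<Rightarrow> real"
  assumes indep: "indep_vars (\<lambda>_. PiM {..<d} (\<lambda>_. borel)) Z I" and I: "finite I" "I \<noteq> {}"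
    and \<tau>: "0 < \<tau>" "24576 * real (d + 1) \<le> \<tau>\<^sup>2 * real (card I)"
  shows "\<exists>E\<in>events. 1 - 8 * exp (- (\<tau>\<^sup>2 * real (card I) / 4096)) \<le> prob E \<and>
    (\<forall>\<omega>\<in>E. \<forall>a r. \<bar>real (card {k\<in>I. r \<le> (\<Sum>j<d. a j * Z k \<omega> j)}) -
      (\<Sum>k\<in>I. prob {\<omega>\<in>space M. r \<le> (\<Sum>j<d. a j * Z k \<omega> j)})\<bar> \<le> 2 * \<tau> * real (card I))"
proof -
  let ?S = "PiM {..<d} (\<lambda>_. borel :: real measure)"
  interpret doubled_sample M ?S Z I
    by unfold_locales (use indep I in auto)
  have space_S: "space ?S = PiE {..<d} (\<lambda>_. UNIV)" by (simp add: space_PiM)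
  have ZS: "Z k \<omega> \<in> PiE {..<d} (\<lambda>_. UNIV)" if "k \<in> I" "\<omega> \<in> space M" for k \<omega>
    using measurable_space[OF rv_Z[OF that(1)] that(2)] by (simp only: space_S)
  let ?H = "rational_halfspaces d"
  have HS: "?H \<subseteq> sets ?S" using sets_halfspace by (auto simp: rational_halfspaces_def)
  define F where "F = {\<omega>\<in>space M. \<exists>h\<in>?H. 2 * \<tau> * real (card I) < \<bar>count_in h (\<lambda>k. Z k \<omega>) - expected_count h\<bar>}"
  have F: "F \<in> events"
  proof -
    have "F = (\<Union>h\<in>?H. {\<omega>\<in>space M. 2 * \<tau> * real (card I) < \<bar>count_in h (\<lambda>k. Z k \<omega>) - expected_count h\<bar>})"
      by (auto simp: F_def)
    also have "\<dots> \<in> events"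
      using HS by (intro sets.countable_UN'[OF countable_rational_halfspaces] borel_measurable_less
        borel_measurable_const borel_measurable_abs borel_measurable_diff measurable_count_in
        image_subsetI rv_Z) auto
    finally show ?thesis .
  qed
  have "prob F \<le> 8 * exp (- (\<tau>\<^sup>2 * real (card I) / 4096))"
    unfolding F_def
  proof (rule uniform_deviation[OF countable_rational_halfspaces HS _ _ \<tau>])
    fix T :: "(nat \<Rightarrow> real) set" assume T: "finite T" "shatters ?H T" "T \<subseteq> space ?S"
    show "card T \<le> d + 1"
      by (rule halfspace_shatters_card_le[OF _ T(1,2)])
        (use T(3) in \<open>auto simp: rational_halfspaces_def space_PiM\<close>)
  qed simp
  then have "1 - 8 * exp (- (\<tau>\<^sup>2 * real (card I) / 4096)) \<le> prob (space M - F)"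
    using prob_compl[OF F] by linarith
  moreover have "\<bar>real (card {k\<in>I. r \<le> (\<Sum>j<d. a j * Z k \<omega> j)}) -
      (\<Sum>k\<in>I. prob {\<omega>\<in>space M. r \<le> (\<Sum>j<d. a j * Z k \<omega> j)})\<bar> \<le> 2 * \<tau> * real (card I)"
    if \<omega>: "\<omega> \<in> space M - F" for \<omega> a r
  proof -
    let ?h = "halfspace d a r"
    obtain h where h: "\<And>n. h n \<in> ?H" and
      lim: "\<And>x. x \<in> PiE {..<d} (\<lambda>_. UNIV) \<Longrightarrow> \<forall>\<^sub>F n in sequentially. x \<in> h n \<longleftrightarrow> x \<in> ?h"
      using halfspace_approximation[of d a r] by blast
    have ind: "(\<lambda>n. indicator (h n) (Z k \<omega>')) \<longlonglongrightarrow> (indicator ?h (Z k \<omega>') :: real)"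
      if "k \<in> I" "\<omega>' \<in> space M" for k \<omega>'
      by (rule tendsto_eventually, rule eventually_mono[OF lim[OF ZS[OF that]]])
        (simp add: indicator_def)
    have c1: "(\<lambda>n. count_in (h n) (\<lambda>k. Z k \<omega>)) \<longlonglongrightarrow> count_in ?h (\<lambda>k. Z k \<omega>)"
      unfolding count_in_def using \<omega> by (intro tendsto_sum ind) auto
    have prob_int: "prob {\<omega>\<in>space M. Z k \<omega> \<in> A} = (\<integral>\<omega>. indicator A (Z k \<omega>) \<partial>M)"
      if "A \<in> sets ?S" "k \<in> I" for A k
    proof -
      have "{\<omega>\<in>space M. Z k \<omega> \<in> A} \<in> events"
        using measurable_sets[OF rv_Z[OF that(2)] that(1)] by (simp add: vimage_def Int_def conj_commute)
      then have "prob {\<omega>\<in>space M. Z k \<omega> \<in> A} = (\<integral>\<omega>. indicator {\<omega>\<in>space M. Z k \<omega> \<in> A} \<omega> \<partial>M)"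
        by simp
      also have "\<dots> = (\<integral>\<omega>. indicator A (Z k \<omega>) \<partial>M)"
        by (rule Bochner_Integration.integral_cong) (auto simp: indicator_def)
      finally show ?thesis .
    qed
    have c2: "(\<lambda>n. expected_count (h n)) \<longlonglongrightarrow> expected_count ?h"
      unfolding expected_count_def
    proof (rule tendsto_sum)
      fix k assume k: "k \<in> I"
      have hn: "h n \<in> sets ?S" for n using h HS by blast
      have meas: "(\<lambda>\<omega>. indicator A (Z k \<omega>) :: real) \<in> borel_measurable M" if "A \<in> sets ?S" for A
        by (rule measurable_compose[OF rv_Z[OF k] borel_measurable_indicator[OF that]])
      have "(\<lambda>n. \<integral>\<omega>. indicator (h n) (Z k \<omega>) \<partial>M) \<longlonglongrightarrow> (\<integral>\<omega>. indicator ?h (Z k \<omega>) \<partial>M :: real)"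
      proof (rule integral_dominated_convergence[where w = "\<lambda>_. 1"])
        show "(\<lambda>\<omega>. indicator ?h (Z k \<omega>) :: real) \<in> borel_measurable M"
          by (rule meas[OF sets_halfspace])
        show "\<And>n. (\<lambda>\<omega>. indicator (h n) (Z k \<omega>) :: real) \<in> borel_measurable M"
          by (rule meas[OF hn])
        show "AE \<omega> in M. (\<lambda>n. indicator (h n) (Z k \<omega>)) \<longlonglongrightarrow> (indicator ?h (Z k \<omega>) :: real)"
          using ind[OF k] by simp
      qed (auto simp: indicator_def)
      then show "(\<lambda>n. prob {\<omega>\<in>space M. Z k \<omega> \<in> h n}) \<longlonglongrightarrow> prob {\<omega>\<in>space M. Z k \<omega> \<in> ?h}"
        using k hn by (simp add: prob_int sets_halfspace)
    qed
    have "(\<lambda>n. \<bar>count_in (h n) (\<lambda>k. Z k \<omega>) - expected_count (h n)\<bar>) \<longlonglongrightarrow>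
        \<bar>count_in ?h (\<lambda>k. Z k \<omega>) - expected_count ?h\<bar>"
      by (intro tendsto_rabs tendsto_diff c1 c2)
    moreover have "\<bar>count_in (h n) (\<lambda>k. Z k \<omega>) - expected_count (h n)\<bar> \<le> 2 * \<tau> * real (card I)" for n
      using \<omega> h[of n] by (auto simp: F_def not_less)
    ultimately have "\<bar>count_in ?h (\<lambda>k. Z k \<omega>) - expected_count ?h\<bar> \<le> 2 * \<tau> * real (card I)"
      by (intro LIMSEQ_le_const2) auto
    moreover have "count_in ?h (\<lambda>k. Z k \<omega>) = real (card {k\<in>I. r \<le> (\<Sum>j<d. a j * Z k \<omega> j)})"
    proof -
      have "count_in ?h (\<lambda>k. Z k \<omega>) = (\<Sum>k\<in>I. if r \<le> (\<Sum>j<d. a j * Z k \<omega> j) then 1 else 0)"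
        unfolding count_in_def by (rule sum.cong) (use ZS \<omega> in \<open>auto simp: halfspace_def\<close>)
      also have "\<dots> = (\<Sum>k\<in>{k\<in>I. r \<le> (\<Sum>j<d. a j * Z k \<omega> j)}. 1)"
        by (rule sum.inter_filter[symmetric]) (rule I(1))
      finally show ?thesis by simp
    qed
    moreover have "expected_count ?h = (\<Sum>k\<in>I. prob {\<omega>\<in>space M. r \<le> (\<Sum>j<d. a j * Z k \<omega> j)})"
      unfolding expected_count_def
      by (intro sum.cong refl arg_cong[where f = prob]) (use ZS in \<open>auto simp: halfspace_def\<close>)
    ultimately show ?thesis by simp
  qed
  ultimately show ?thesis by (intro bexI[of _ "space M - F"]) (use F in auto)
qed

section \<open>Medians and quantiles\<close>

lemma sorted_nth_ge:
  fixes xs :: "'b::linorder list"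
  assumes "sorted xs" "i < length xs" "length xs \<le> length (filter (\<lambda>x. c \<le> x) xs) + i"
  shows "c \<le> xs ! i"
proof (rule ccontr)
  assume "\<not> c \<le> xs ! i"
  then have less: "xs ! j < c" if "j \<le> i" for j
    using sorted_nth_mono[OF assms(1) that assms(2)] by simp
  have "{j. j < length xs \<and> c \<le> xs ! j} \<subseteq> {Suc i..<length xs}"
  proof
    fix j assume "j \<in> {j. j < length xs \<and> c \<le> xs ! j}"
    then show "j \<in> {Suc i..<length xs}" using less[of j] by (cases "j \<le> i") auto
  qed
  then have "card {j. j < length xs \<and> c \<le> xs ! j} \<le> length xs - Suc i"
    using card_mono[of "{Suc i..<length xs}"] by fastforce
  then show False using assms(2,3) by (simp add: length_filter_conv_card)
qed

lemma sorted_nth_le: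
  fixes xs :: "'b::linorder list"
  assumes "sorted xs" "i < length (filter (\<lambda>x. x \<le> c) xs)"
  shows "xs ! i \<le> c"
proof (rule ccontr)
  assume "\<not> xs ! i \<le> c"
  moreover have "i < length xs" using assms(2) length_filter_le[of "\<lambda>x. x \<le> c" xs] by linarith
  ultimately have gr: "c < xs ! j" if "i \<le> j" "j < length xs" for j
    using sorted_nth_mono[OF assms(1) that] by simp
  have "{j. j < length xs \<and> xs ! j \<le> c} \<subseteq> {..<i}"
  proof
    fix j assume "j \<in> {j. j < length xs \<and> xs ! j \<le> c}"
    then show "j \<in> {..<i}" using gr[of j] by (cases "i \<le> j") auto
  qed
  then have "card {j. j < length xs \<and> xs ! j \<le> c} \<le> i"
    using card_mono[of "{..<i}"] by fastforce
  then show False using assms(2) by (simp add: length_filter_conv_card)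
qed

lemma length_filter_sort_map:
  "length (filter P (sort (map f [1..<Suc K]))) = card {k\<in>{1..K}. P (f k)}"
proof -
  have "length (filter P (sort (map f xs))) = length (filter (\<lambda>k. P (f k)) xs)" for xs
  proof -
    have "mset (filter P (sort (map f xs))) = mset (filter P (map f xs))"
      unfolding mset_filter mset_sort ..
    then have "length (filter P (sort (map f xs))) = length (filter P (map f xs))"
      by (rule mset_eq_length)
    then show ?thesis by (simp only: filter_map length_map o_def)
  qed
  then have "length (filter P (sort (map f [1..<Suc K]))) = length (filter (\<lambda>k. P (f k)) [1..<Suc K])" .
  also have "\<dots> = card (set (filter (\<lambda>k. P (f k)) [1..<Suc K]))"
    by (rule distinct_card[symmetric]) simp
  also have "set (filter (\<lambda>k. P (f k)) [1..<Suc K]) = {k\<in>{1..K}. P (f k)}" by auto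
  finally show ?thesis .
qed

lemma Med_ge:
  assumes "K < 2 * card {k\<in>{1..K}. c \<le> f k}"
  shows "c \<le> Med K f"
proof -
  define xs where "xs = sort (map f [1..<Suc K])"
  have len: "length xs = K" "length (filter (\<lambda>x. c \<le> x) xs) = card {k\<in>{1..K}. c \<le> f k}"
    unfolding xs_def length_filter_sort_map by simp_all
  have K: "0 < K" using assms by (cases K) auto
  have ge: "c \<le> xs ! i" if "i < K" "K - i \<le> card {k\<in>{1..K}. c \<le> f k}" for i
    by (rule sorted_nth_ge) (use that len in \<open>auto simp: xs_def\<close>)
  show ?thesis
  proof (cases "odd K")
    case True
    then have "c \<le> xs ! (K div 2)" using assms K by (intro ge) (auto elim!: oddE)
    then show ?thesis using True by (simp add: Med_def xs_def Let_def)
  next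
    case False
    then have "c \<le> xs ! (K div 2 - 1)" "c \<le> xs ! (K div 2)"
      using assms K by (auto intro!: ge elim!: evenE)
    then show ?thesis using False by (simp add: Med_def xs_def Let_def)
  qed
qed

lemma Med_le:
  assumes "K < 2 * card {k\<in>{1..K}. f k \<le> c}"
  shows "Med K f \<le> c"
proof -
  define xs where "xs = sort (map f [1..<Suc K])"
  have len: "length xs = K" "length (filter (\<lambda>x. x \<le> c) xs) = card {k\<in>{1..K}. f k \<le> c}"
    unfolding xs_def length_filter_sort_map by simp_all
  have K: "0 < K" using assms by (cases K) auto
  have le: "xs ! i \<le> c" if "i < card {k\<in>{1..K}. f k \<le> c}" for i
    by (rule sorted_nth_le) (use that len in \<open>auto simp: xs_def\<close>)
  show ?thesis
  proof (cases "odd K")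
    case True
    then have "xs ! (K div 2) \<le> c" using assms K by (intro le) (auto elim!: oddE)
    then show ?thesis using True by (simp add: Med_def xs_def Let_def)
  next
    case False
    then have "xs ! (K div 2 - 1) \<le> c" "xs ! (K div 2) \<le> c"
      using assms K by (auto intro!: le elim!: evenE)
    then show ?thesis using False by (simp add: Med_def xs_def Let_def)
  qed
qed

lemma card_compl_less:
  "card {k\<in>{1..K}. y k \<le> (c::real)} = K - card {k\<in>{1..K::nat}. c < y k}"
proof -
  have "{k\<in>{1..K}. y k \<le> c} = {1..K} - {k\<in>{1..K}. c < y k}" by auto
  also have "card \<dots> = card {1..K} - card {k\<in>{1..K}. c < y k}"
    by (rule card_Diff_subset) auto
  finally show ?thesis by simp
qed

text \<open>
  The median absolute deviation is determined up to constants by six empirical quantiles. Here \<open>q14\<close>,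
  \<open>q12\<close>, \<open>q34\<close> are exceeded by less than \<open>1/4\<close>, \<open>1/2\<close>, \<open>3/4\<close> of the data, and \<open>p14\<close>, \<open>p12\<close>, \<open>p34\<close> are reached by
  more than these proportions, so the median lies in \<open>[p12, q12]\<close>. More than half of the data lie in
  \<open>[p34, q14]\<close>, hence within \<open>U\<close> of the median. More than a quarter are at least \<open>p14\<close> and more than a quarter
  at most \<open>q34\<close>; these are two disjoint groups at distance at least \<open>L\<close> from the median.
\<close>

lemma MAD_bounds:
  fixes y :: "nat \<Rightarrow> real"
  assumes above_14: "4 * card {k\<in>{1..K}. q14 < y k} < K"
    and above_12: "2 * card {k\<in>{1..K}. q12 < y k} < K"
    and above_34: "4 * card {k\<in>{1..K}. q34 < y k} < 3 * K"
    and from_14: "K < 4 * card {k\<in>{1..K}. p14 \<le> y k}"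
    and from_12: "K < 2 * card {k\<in>{1..K}. p12 \<le> y k}"
    and from_34: "3 * K < 4 * card {k\<in>{1..K}. p34 \<le> y k}"
    and U: "q14 - p12 \<le> U" "q12 - p34 \<le> U"
    and L: "L \<le> p14 - q12" "L \<le> p12 - q34" "0 < L"
  shows "L \<le> Med K (\<lambda>k. \<bar>y k - Med K y\<bar>)" and "Med K (\<lambda>k. \<bar>y k - Med K y\<bar>) \<le> U"
proof -
  have med_ge: "p12 \<le> Med K y" by (rule Med_ge[OF from_12])
  have med_le: "Med K y \<le> q12" by (rule Med_le) (use above_12 card_compl_less[of K y q12] in linarith)
  show "L \<le> Med K (\<lambda>k. \<bar>y k - Med K y\<bar>)"
  proof (rule Med_ge)
    let ?A = "{k\<in>{1..K}. p14 \<le> y k}" and ?B = "{k\<in>{1..K}. y k \<le> q34}"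
    have disj: "?A \<inter> ?B = {}" using L med_ge med_le by auto
    have "K < 4 * card ?B" using above_34 card_compl_less[of K y q34] by linarith
    moreover have "K < 2 * (a + b)" if "K < 4 * a" "K < 4 * b" for a b :: nat
      using that by presburger
    ultimately have "K < 2 * (card ?A + card ?B)" using from_14 by blast
    also have "card ?A + card ?B = card (?A \<union> ?B)" by (rule card_Un_disjoint[symmetric]) (use disj in auto)
    also have "2 * \<dots> \<le> 2 * card {k\<in>{1..K}. L \<le> \<bar>y k - Med K y\<bar>}"
      by (intro mult_left_mono card_mono) (use L med_ge med_le in auto)
    finally show "K < 2 * card {k\<in>{1..K}. L \<le> \<bar>y k - Med K y\<bar>}" .
  qed
  show "Med K (\<lambda>k. \<bar>y k - Med K y\<bar>) \<le> U"
  proof (rule Med_le)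
    let ?A = "{k\<in>{1..K}. p34 \<le> y k}" and ?B = "{k\<in>{1..K}. q14 < y k}"
    have "card ?A \<le> card ((?A - ?B) \<union> ?B)" by (intro card_mono) auto
    also have "\<dots> \<le> card (?A - ?B) + card ?B" by (rule card_Un_le)
    finally have "K < 2 * card (?A - ?B)" using from_34 above_14 by linarith
    also have "\<dots> \<le> 2 * card {k\<in>{1..K}. \<bar>y k - Med K y\<bar> \<le> U}"
      by (intro mult_left_mono card_mono) (use U med_ge med_le in auto)
    finally show "K < 2 * card {k\<in>{1..K}. \<bar>y k - Med K y\<bar> \<le> U}" .
  qed
qed

text \<open>
  The maximum in the definition of the upper quantile is attained since \<open>r \<mapsto> P(r \<le> V)\<close> is left
  continuous and tends to \<open>1\<close> and \<open>0\<close> at the two ends. Both facts are read off from the distribution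
  function of \<open>- V\<close>, evaluated at \<open>- r\<close>.
\<close>

lemma (in prob_space) upper_quantile:
  fixes V :: "'a \<Rightarrow> real"
  assumes V [measurable]: "V \<in> borel_measurable M" and p: "0 < p" "p < 1"
  defines "H \<equiv> \<lambda>r. prob {\<omega>\<in>space M. r \<le> V \<omega>}"
  shows "p \<le> H (GREATEST r. p \<le> H r)" and "(GREATEST r. p \<le> H r) < s \<Longrightarrow> H s < p"
proof -
  let ?D = "distr M borel (\<lambda>\<omega>. - V \<omega>)"
  interpret D: real_distribution ?D
    by (intro real_distribution_distr) simp
  have H: "H r = cdf ?D (- r)" for r
    unfolding H_def cdf_def by (subst measure_distr) (auto intro!: arg_cong[where f=prob])
  let ?A = "{t. p \<le> cdf ?D t}"
  have "\<forall>\<^sub>F t in at_top. p < cdf ?D t"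
    using D.cdf_lim_at_top_prob p by (intro order_tendstoD) auto
  then have ne: "?A \<noteq> {}" using eventually_happens[of _ "at_top :: real filter"] by (force intro: less_imp_le)
  have "\<forall>\<^sub>F t in at_bot. cdf ?D t < p"
    using D.cdf_lim_at_bot p by (intro order_tendstoD) auto
  then obtain b where b: "\<And>t. t \<le> b \<Longrightarrow> cdf ?D t < p"
    by (auto simp: eventually_at_bot_linorder)
  have bdd: "bdd_below ?A"
  proof (rule bdd_belowI)
    fix t assume "t \<in> ?A"
    then show "b \<le> t" using b[of t] by (cases "t \<le> b") auto
  qed
  define t0 where "t0 = Inf ?A"
  have t0: "p \<le> cdf ?D t0"
  proof (rule ccontr)
    assume "\<not> ?thesis"
    then have "cdf ?D t0 < p" by simp
    then have "\<forall>\<^sub>F t in at_right t0. cdf ?D t < p"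
      using D.cdf_is_right_cont[of t0] unfolding continuous_within by (intro order_tendstoD) auto
    then obtain c where c: "t0 < c" "\<And>t. t0 < t \<Longrightarrow> t < c \<Longrightarrow> cdf ?D t < p"
      by (auto simp: eventually_at_right_field)
    obtain t where "t \<in> ?A" "t < c" using cInf_lessD[OF ne, of c] c(1) by (auto simp: t0_def)
    moreover have "t0 \<le> t" unfolding t0_def by (rule cInf_lower[OF \<open>t \<in> ?A\<close> bdd])
    ultimately show False using c(2)[of t] \<open>cdf ?D t0 < p\<close> by (cases "t = t0") auto
  qed
  have G: "(GREATEST r. p \<le> H r) = - t0"
  proof (rule Greatest_equality)
    show "p \<le> H (- t0)" using t0 by (simp add: H)
    fix r assume "p \<le> H r"
    then have "t0 \<le> - r" unfolding t0_def by (intro cInf_lower bdd) (simp add: H)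
    then show "r \<le> - t0" by simp
  qed
  show "p \<le> H (GREATEST r. p \<le> H r)" using t0 unfolding G by (simp add: H)
  show "H s < p" if "(GREATEST r. p \<le> H r) < s"
  proof (rule ccontr)
    assume "\<not> H s < p"
    then have "t0 \<le> - s" unfolding t0_def by (intro cInf_lower bdd) (simp add: H)
    then show False using that by (simp add: G)
  qed
qed

section \<open>Standardized block means\<close>

text \<open>
  If \<open>B\<close> inverts \<open>S = R * R\<close>, then \<open>R * B\<close> inverts \<open>R\<close> on both sides, so \<open>mat_inverse\<close> does not return \<open>None\<close>.
\<close>

lemma psd_sqrt_inverse:
  fixes R :: "real mat"
  assumes R: "is_psd_sqrt d R S" and S: "invertible_mat S"
  defines "T \<equiv> the (mat_inverse R)"
  shows "T \<in> carrier_mat d d" "R * T = 1\<^sub>m d" "T * R = 1\<^sub>m d"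
proof -
  have RC: "R \<in> carrier_mat d d" and RR: "R * R = S" using R by (auto simp: is_psd_sqrt_def)
  have SC: "S \<in> carrier_mat d d" using RC RR by auto
  obtain B where B: "inverts_mat S B" "inverts_mat B S" using S by (auto simp: invertible_mat_def)
  have SB: "S * B = 1\<^sub>m d" using B(1) SC by (simp add: inverts_mat_def)
  have "dim_col (S * B) = d" using SB by simp
  then have "dim_col B = d" by simp
  moreover have "B * S = 1\<^sub>m (dim_row B)" using B(2) by (simp add: inverts_mat_def)
  then have "dim_col (B * S) = dim_row B" by simp
  then have "dim_row B = d" using SC by simp
  ultimately have BC: "B \<in> carrier_mat d d" by auto
  have BS: "B * S = 1\<^sub>m d" using \<open>B * S = 1\<^sub>m (dim_row B)\<close> \<open>dim_row B = d\<close> by simp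
  have r: "R * (R * B) = 1\<^sub>m d"
    using SB assoc_mult_mat[OF RC RC BC] RR by simp
  have l: "(B * R) * R = 1\<^sub>m d"
    using BS assoc_mult_mat[OF BC RC RC] RR by simp
  have RBC: "R * B \<in> carrier_mat d d" "B * R \<in> carrier_mat d d" using RC BC by auto
  have "B * R = (B * R) * (R * (R * B))" unfolding r by (rule right_mult_one_mat[OF RBC(2), symmetric])
  also have "\<dots> = ((B * R) * R) * (R * B)" by (rule assoc_mult_mat[OF RBC(2) RC RBC(1), symmetric])
  also have "\<dots> = R * B" unfolding l by (rule left_mult_one_mat[OF RBC(1)])
  finally have "B * R = R * B" .
  then have "R * (R * B) = 1\<^sub>m d" "(R * B) * R = 1\<^sub>m d" using r l by simp_all
  then have "R \<in> Units (ring_mat TYPE(real) d ())"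
    using RC RBC(1) unfolding Units_def ring_mat_def by auto
  then obtain C where C: "mat_inverse R = Some C"
    using mat_inverse(1)[OF RC, where b = "()"] by (cases "mat_inverse R") auto
  show "T \<in> carrier_mat d d" "R * T = 1\<^sub>m d" "T * R = 1\<^sub>m d"
    using mat_inverse(2)[OF RC C] by (simp_all add: T_def C)
qed

lemma scalar_prod_eq_sum:
  "v \<in> carrier_vec d \<Longrightarrow> scalar_prod x v = (\<Sum>j<d. vec_index v j * vec_index x j)"
  for v :: "real Matrix.vec"
  by (auto simp: scalar_prod_def atLeast0LessThan mult.commute)

lemma scalar_prod_block_mean:
  assumes "v \<in> carrier_vec d"
  shows "scalar_prod (block_mean d x I) v =
    (\<Sum>j<d. vec_index v j * ((\<Sum>i\<in>I. vec_index (x i) j) / real (card I)))"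
  unfolding scalar_prod_eq_sum[OF assms] by (rule sum.cong) (auto simp: block_mean_def)

text \<open>
  Since \<open>R\<close> is symmetric, projecting \<open>R\<^sup>-\<^sup>1 (x - \<mu>)\<close> onto \<open>R v\<close> is projecting \<open>x - \<mu>\<close> onto \<open>v\<close>. Standardized block
  sums in direction \<open>R v\<close> are thus an affine image of the projected block means, with a scale that
  depends on the block through its size only.
\<close>

lemma standardized_sum_eq:
  fixes R :: "real mat"
  assumes R: "is_psd_sqrt d R S" "invertible_mat S" and \<mu>: "\<mu> \<in> carrier_vec d"
    and v: "v \<in> carrier_vec d" and x: "\<And>i. i \<in> I \<Longrightarrow> x i \<in> carrier_vec d" and I: "0 < card I"
  shows "1 / sqrt (real (card I)) * (\<Sum>i\<in>I. scalar_prod (the (mat_inverse R) *\<^sub>v (x i - \<mu>)) (a \<cdot>\<^sub>v (R *\<^sub>v v)))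
    = a * sqrt (real (card I)) * (scalar_prod (block_mean d x I) v - scalar_prod \<mu> v)"
proof -
  let ?T = "the (mat_inverse R)" and ?n = "real (card I)"
  have RC: "R \<in> carrier_mat d d" "transpose_mat R = R" using R(1) by (auto simp: is_psd_sqrt_def)
  note T = psd_sqrt_inverse[OF R]
  have one: "scalar_prod (?T *\<^sub>v (x i - \<mu>)) (a \<cdot>\<^sub>v (R *\<^sub>v v)) =
      a * (scalar_prod (x i) v - scalar_prod \<mu> v)" if "i \<in> I" for i
  proof -
    have z: "x i - \<mu> \<in> carrier_vec d" using x[OF that] \<mu> by auto
    have Tz: "?T *\<^sub>v (x i - \<mu>) \<in> carrier_vec d" using T(1) z by auto
    have "scalar_prod (?T *\<^sub>v (x i - \<mu>)) (a \<cdot>\<^sub>v (R *\<^sub>v v)) = a * scalar_prod (?T *\<^sub>v (x i - \<mu>)) (R *\<^sub>v v)"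
      using Tz RC v by (intro scalar_prod_smult_distrib) auto
    also have "scalar_prod (?T *\<^sub>v (x i - \<mu>)) (R *\<^sub>v v) = scalar_prod (R *\<^sub>v (?T *\<^sub>v (x i - \<mu>))) v"
      using transpose_vec_mult_scalar[OF RC(1) v Tz] RC(2) by simp
    also have "R *\<^sub>v (?T *\<^sub>v (x i - \<mu>)) = x i - \<mu>"
      using assoc_mult_mat_vec[OF RC(1) T(1) z] T(2) z by simp
    finally show ?thesis using minus_scalar_prod_distrib[OF x[OF that] \<mu> v] by simp
  qed
  have mean: "scalar_prod (block_mean d x I) v * ?n = (\<Sum>i\<in>I. scalar_prod (x i) v)"
  proof -
    have "(\<Sum>i\<in>I. scalar_prod (x i) v) = (\<Sum>j<d. \<Sum>i\<in>I. vec_index v j * vec_index (x i) j)"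
      unfolding scalar_prod_eq_sum[OF v] by (rule sum.swap)
    also have "\<dots> = scalar_prod (block_mean d x I) v * ?n"
      unfolding scalar_prod_block_mean[OF v] using I
      by (simp add: sum_distrib_left sum_distrib_right sum_divide_distrib)
    finally show ?thesis ..
  qed
  have "(\<Sum>i\<in>I. scalar_prod (?T *\<^sub>v (x i - \<mu>)) (a \<cdot>\<^sub>v (R *\<^sub>v v))) =
      (\<Sum>i\<in>I. a * (scalar_prod (x i) v - scalar_prod \<mu> v))"
    by (rule sum.cong[OF refl one])
  also have "\<dots> = a * ((\<Sum>i\<in>I. scalar_prod (x i) v) - ?n * scalar_prod \<mu> v)"
    by (simp add: sum_subtractf flip: sum_distrib_left)
  also have "\<dots> = a * ?n * (scalar_prod (block_mean d x I) v - scalar_prod \<mu> v)"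
    unfolding mean[symmetric] by (simp add: algebra_simps)
  finally have *: "(\<Sum>i\<in>I. scalar_prod (?T *\<^sub>v (x i - \<mu>)) (a \<cdot>\<^sub>v (R *\<^sub>v v))) =
      a * ?n * (scalar_prod (block_mean d x I) v - scalar_prod \<mu> v)" .
  have "?n / sqrt ?n = sqrt ?n" by (rule real_div_sqrt) simp
  then have sq: "1 / sqrt ?n * ?n = sqrt ?n" by simp
  have "1 / sqrt ?n * (a * ?n * (scalar_prod (block_mean d x I) v - scalar_prod \<mu> v)) =
      a * (1 / sqrt ?n * ?n) * (scalar_prod (block_mean d x I) v - scalar_prod \<mu> v)"
    by (simp add: mult_ac)
  then show ?thesis unfolding * sq .
qed

lemma euclid_norm_nonneg: "0 \<le> euclid_norm v"
  by (auto simp: euclid_norm_def scalar_prod_def intro!: sum_nonneg)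

lemma euclid_norm_sq: "(euclid_norm v)\<^sup>2 = scalar_prod v v"
  unfolding euclid_norm_def by (rule real_sqrt_pow2) (auto simp: scalar_prod_def intro!: sum_nonneg)

lemma euclid_norm_eq_0:
  assumes "v \<in> carrier_vec d" "euclid_norm v = 0"
  shows "v = 0\<^sub>v d"
proof -
  have "(\<Sum>j<d. vec_index v j * vec_index v j) = 0"
    using euclid_norm_sq[of v] assms scalar_prod_eq_sum[OF assms(1), of v] by simp
  then have "\<forall>j<d. vec_index v j * vec_index v j = 0"
    by (subst (asm) sum_nonneg_eq_0_iff) auto
  then show ?thesis using assms(1) by (intro eq_vecI) auto
qed

lemma euclid_norm_normalize:
  assumes "v \<in> carrier_vec d" "euclid_norm v \<noteq> 0"
  shows "euclid_norm ((1 / euclid_norm v) \<cdot>\<^sub>v v) = 1"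
proof -
  have "scalar_prod ((1 / euclid_norm v) \<cdot>\<^sub>v v) ((1 / euclid_norm v) \<cdot>\<^sub>v v) =
      (1 / euclid_norm v)\<^sup>2 * scalar_prod v v"
    using assms(1) by (simp add: power2_eq_square)
  also have "\<dots> = 1" using assms(2) by (simp add: power_divide flip: euclid_norm_sq)
  finally show ?thesis by (simp add: euclid_norm_def)
qed

lemma measurable_vec_index:
  assumes "j < d"
  shows "(\<lambda>x. vec_index x j) \<in> borel_measurable (borel_vec d)"
proof -
  have "(\<lambda>x. \<lambda>j\<in>{..<d}. vec_index x j) \<in> measurable (borel_vec d) (PiM {..<d} (\<lambda>_. borel))"
    unfolding borel_vec_def by (rule measurable_vimage_algebra1) (simp add: space_PiM)
  from measurable_compose[OF this measurable_component_singleton[of j]] assms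
  show ?thesis by simp
qed

lemma card_le_card_add_modified:
  assumes "finite A" "card {k\<in>A. y k \<noteq> z k} \<le> m"
  shows "card {k\<in>A. P (y k)} \<le> card {k\<in>A. P (z k)} + m"
proof -
  have "card {k\<in>A. P (y k)} \<le> card ({k\<in>A. P (z k)} \<union> {k\<in>A. y k \<noteq> z k})"
    using assms(1) by (intro card_mono) auto
  also have "\<dots> \<le> card {k\<in>A. P (z k)} + card {k\<in>A. y k \<noteq> z k}" by (rule card_Un_le)
  finally show ?thesis using assms(2) by linarith
qed

text \<open>
  The blocks are disjoint, so distinct affected blocks contain distinct modified indices.
\<close>

lemma card_modified_blocks_le:
  assumes B: "is_block_partition N K B" and m: "card {i\<in>{1..N}. x i \<noteq> x' i} \<le> m"
    and y: "\<And>k. k \<in> {1..K} \<Longrightarrow> (\<And>i. i \<in> B k \<Longrightarrow> x i = x' i) \<Longrightarrow> y k = z k"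
  shows "card {k\<in>{1..K}. y k \<noteq> z k} \<le> m"
proof -
  have "\<exists>i. i \<in> B k \<and> x i \<noteq> x' i" if "k \<in> {k\<in>{1..K}. y k \<noteq> z k}" for k
    using y[of k] that by auto
  then obtain f where f: "\<And>k. k \<in> {k\<in>{1..K}. y k \<noteq> z k} \<Longrightarrow> f k \<in> B k \<and> x (f k) \<noteq> x' (f k)"
    by metis
  have "inj_on f {k\<in>{1..K}. y k \<noteq> z k}"
  proof (rule inj_onI)
    fix k l assume kl: "k \<in> {k\<in>{1..K}. y k \<noteq> z k}" "l \<in> {k\<in>{1..K}. y k \<noteq> z k}" "f k = f l"
    then have "f k \<in> B k \<inter> B l" using f[of k] f[of l] by auto
    moreover have "disjoint_family_on B {1..K}" using B by (simp add: is_block_partition_def)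
    ultimately show "k = l" using kl(1,2) disjoint_family_onD[of B "{1..K}" k l] by auto
  qed
  moreover have "f ` {k\<in>{1..K}. y k \<noteq> z k} \<subseteq> {i\<in>{1..N}. x i \<noteq> x' i}"
  proof
    fix i assume "i \<in> f ` {k\<in>{1..K}. y k \<noteq> z k}"
    then obtain k where k: "k \<in> {k\<in>{1..K}. y k \<noteq> z k}" "i = f k" by auto
    then have "i \<in> (\<Union>k\<in>{1..K}. B k)" using f[of k] by auto
    then have "i \<in> {1..N}" using B by (simp only: is_block_partition_def)
    then show "i \<in> {i\<in>{1..N}. x i \<noteq> x' i}" using f[OF k(1)] k(2) by simp
  qed
  ultimately have "card {k\<in>{1..K}. y k \<noteq> z k} \<le> card {i\<in>{1..N}. x i \<noteq> x' i}"
    by (intro card_inj_on_le) auto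
  then show ?thesis using m by linarith
qed

lemma (in prob_space) indep_vars_block_means:
  assumes B: "is_block_partition N K B" and X: "indep_vars (\<lambda>_. borel_vec d) X {1..N}"
  shows "indep_vars (\<lambda>_. PiM {..<d} (\<lambda>_. borel))
    (\<lambda>k \<omega>. \<lambda>j\<in>{..<d}. (\<Sum>i\<in>B k. vec_index (X i \<omega>) j) / real (card (B k))) {1..K}"
proof -
  have sub: "B k \<subseteq> {1..N}" if "k \<in> {1..K}" for k using B that by (auto simp: is_block_partition_def)
  have "indep_vars (\<lambda>k. PiM (B k) (\<lambda>_. borel_vec d)) (\<lambda>k \<omega>. restrict (\<lambda>i. X i \<omega>) (B k)) {1..K}"
    by (rule indep_vars_restrict[OF X sub]) (use B in \<open>simp_all add: is_block_partition_def\<close>)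
  then have "indep_vars (\<lambda>_. PiM {..<d} (\<lambda>_. borel))
    (\<lambda>k \<omega>. (\<lambda>x. \<lambda>j\<in>{..<d}. (\<Sum>i\<in>B k. vec_index (x i) j) / real (card (B k))) (restrict (\<lambda>i. X i \<omega>) (B k))) {1..K}"
  proof (rule indep_vars_compose2)
    fix k
    show "(\<lambda>x. \<lambda>j\<in>{..<d}. (\<Sum>i\<in>B k. vec_index (x i) j) / real (card (B k)))
      \<in> measurable (PiM (B k) (\<lambda>_. borel_vec d)) (PiM {..<d} (\<lambda>_. borel))"
    proof (intro measurable_restrict borel_measurable_divide borel_measurable_sum borel_measurable_const)
      fix j i assume "j \<in> {..<d}" "i \<in> B k"
      then show "(\<lambda>x. vec_index (x i) j) \<in> borel_measurable (PiM (B k) (\<lambda>_. borel_vec d))"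
        using measurable_compose[OF measurable_component_singleton[of i "B k" "\<lambda>_. borel_vec d"] measurable_vec_index[of j d]]
        by simp
    qed
  qed
  then show ?thesis by (simp cong: sum.cong)
qed

text \<open>
  Transfers population quantiles \<open>w\<close> to the sample \<open>y\<close>. The uniform bound \<open>dev\<close> speaks of closed half-lines
  only; for the number of points strictly above \<open>c + s * w\<close> it is applied at the smallest such point,
  which corresponds to some \<open>r > w\<close>.
\<close>

lemma counts_at_quantiles:
  fixes y :: "nat \<Rightarrow> real" and h :: "real \<Rightarrow> real"
  assumes K: "1 \<le> K" and s: "0 < s"
    and dev: "\<And>r. \<bar>real (card {k\<in>{1..K}. c + s * r \<le> y k}) - real K * h r\<bar> < 2 * \<epsilon> * real K"
  shows "p + 2 * \<epsilon> \<le> h w \<Longrightarrow> p * real K < real (card {k\<in>{1..K}. c + s * w \<le> y k})"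
    and "(\<And>r. w < r \<Longrightarrow> h r < p - 2 * \<epsilon>) \<Longrightarrow> real (card {k\<in>{1..K}. c + s * w < y k}) < p * real K"
proof -
  assume "p + 2 * \<epsilon> \<le> h w"
  then have "real K * (p + 2 * \<epsilon>) \<le> real K * h w" by (intro mult_left_mono) auto
  then show "p * real K < real (card {k\<in>{1..K}. c + s * w \<le> y k})"
    using dev[of w] by (simp add: algebra_simps)
next
  assume h: "\<And>r. w < r \<Longrightarrow> h r < p - 2 * \<epsilon>"
  let ?A = "{k\<in>{1..K}. c + s * w < y k}"
  define r where "r = (if ?A = {} then w + 1 else (Min (y ` ?A) - c) / s)"
  have "w < r"
  proof (cases "?A = {}")
    case False
    then have "c + s * w < Min (y ` ?A)" by (subst Min_gr_iff) auto
    then show ?thesis using s False by (simp add: r_def field_simps)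
  qed (simp add: r_def)
  have "c + s * r \<le> y k" if "k \<in> ?A" for k
  proof -
    have "c + s * r = Min (y ` ?A)" using that s unfolding r_def by auto
    then show ?thesis using that by simp
  qed
  then have "card ?A \<le> card {k\<in>{1..K}. c + s * r \<le> y k}" by (intro card_mono) auto
  moreover have "real K * h r < real K * (p - 2 * \<epsilon>)"
    using h[OF \<open>w < r\<close>] K by (intro mult_strict_left_mono) auto
  ultimately show "real (card ?A) < p * real K"
    using dev[of r] by (simp add: algebra_simps)
qed

section \<open>Uniform bounds for the median absolute deviation\<close>

text \<open>
  The constants come from spending \<open>\<epsilon> K / 2\<close> of the deviation \<open>2 \<epsilon> K\<close> on sampling, that is \<open>\<tau> = \<epsilon> / 4\<close>, and \<open>\<epsilon> K\<close>
  on corrupted blocks. The remaining \<open>\<epsilon> K / 2\<close> makes the inequalities between counts strict, as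
  medians require. With \<open>d + 1 \<le> 2 d\<close>, the condition of the deviation bound becomes
  \<open>2 * 24576 * 16 * d \<le> \<epsilon>\<^sup>2 K\<close>, and half of its exponent \<open>\<epsilon>\<^sup>2 K / 65536\<close> absorbs the factor \<open>8\<close>.
\<close>

lemma (in prob_space) MOMAD_bounds:
  fixes N d K m :: nat and B :: "nat \<Rightarrow> nat set" and Xt X :: "nat \<Rightarrow> 'a \<Rightarrow> real Matrix.vec"
    and \<mu> :: "real Matrix.vec" and \<Sigma> R :: "real mat" and \<epsilon> \<phi>l \<phi>u :: real
  assumes K: "K \<in> {1..N}" "K dvd N" and d: "1 \<le> d"
    and B: "is_block_partition N K B"
    and indep: "indep_vars (\<lambda>_. borel_vec d) Xt {1..N}"
    and \<mu>: "\<mu> \<in> carrier_vec d" and R: "is_psd_sqrt d R \<Sigma>" "invertible_mat \<Sigma>"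
    and law: "common_block_law M Xt \<mu> R d N K B"
    and X: "corrupted_version M d N m Xt X"
    and \<epsilon>: "0 < \<epsilon>" "\<epsilon> < 1/8" and \<phi>: "0 < \<phi>l"
    and gaps: "\<And>v. v \<in> carrier_vec d \<Longrightarrow> euclid_norm v = 1 \<Longrightarrow>
      (let w = W_fun M Xt \<mu> R N K v in
        max (w (1/4 - 2*\<epsilon>) - w (1/2 + 2*\<epsilon>)) (w (1/2 - 2*\<epsilon>) - w (3/4 + 2*\<epsilon>)) \<le> \<phi>u \<and>
        min (w (1/4 + 2*\<epsilon>) - w (1/2 - 2*\<epsilon>)) (w (1/2 + 2*\<epsilon>) - w (3/4 - 2*\<epsilon>)) \<ge> \<phi>l)"
    and m: "real m \<le> \<epsilon> * real K"
    and Kd: "786432 * real d \<le> \<epsilon>\<^sup>2 * real K"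
  shows "\<exists>E\<in>events. 1 - exp (- (1/131072) * \<epsilon>\<^sup>2 * real K) \<le> prob E \<and>
    (\<forall>\<omega>\<in>E. \<forall>v\<in>carrier_vec d.
      \<phi>l * sqrt (real K / real N) * euclid_norm (R *\<^sub>v v) \<le> MOMAD d K B (\<lambda>i. X i \<omega>) v \<and>
      MOMAD d K B (\<lambda>i. X i \<omega>) v \<le> \<phi>u * sqrt (real K / real N) * euclid_norm (R *\<^sub>v v))"
proof -
  define n where "n = N div K"
  have N: "real N = real K * real n" using K(2) by (simp add: n_def flip: of_nat_mult)
  have Kpos: "1 \<le> K" "0 < real K" using K(1) by auto
  have n: "0 < real n" using N K by (cases "n = 0") auto
  have cardB: "card (B k) = n" if "k \<in> {1..K}" for k
    using B that by (auto simp: is_block_partition_def n_def)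
  have RC: "R \<in> carrier_mat d d" using R(1) by (simp add: is_psd_sqrt_def)
  have XtC: "Xt i \<omega> \<in> carrier_vec d" if "i \<in> {1..N}" "\<omega> \<in> space M" for i \<omega>
  proof -
    have "Xt i \<in> measurable M (borel_vec d)" using indep that(1) by (auto simp: indep_vars_def)
    from measurable_space[OF this that(2)] show ?thesis by (simp add: borel_vec_def)
  qed
  have Bsub: "B k \<subseteq> {1..N}" if "k \<in> {1..K}" for k
    using B that unfolding is_block_partition_def by (metis UN_upper)

  define Z where "Z = (\<lambda>k \<omega>. \<lambda>j\<in>{..<d}. (\<Sum>i\<in>B k. vec_index (Xt i \<omega>) j) / real (card (B k)))"
  have indepZ: "indep_vars (\<lambda>_. PiM {..<d} (\<lambda>_. borel)) Z {1..K}"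
    unfolding Z_def by (rule indep_vars_block_means[OF B indep])
  have Z_eq: "(\<Sum>j<d. vec_index v j * Z k \<omega> j) = scalar_prod (block_mean d (\<lambda>i. Xt i \<omega>) (B k)) v"
    if "v \<in> carrier_vec d" for v k \<omega>
    unfolding scalar_prod_block_mean[OF that] by (rule sum.cong) (auto simp: Z_def)

  define \<tau> where "\<tau> = \<epsilon> / 4"
  have \<tau>: "0 < \<tau>" "24576 * real (d + 1) \<le> \<tau>\<^sup>2 * real (card {1..K})"
    using \<epsilon> Kd d by (auto simp: \<tau>_def power_divide)
  obtain E where E: "E \<in> events" "1 - 8 * exp (- (\<tau>\<^sup>2 * real (card {1..K}) / 4096)) \<le> prob E"
    and dev: "\<And>\<omega> a r. \<omega> \<in> E \<Longrightarrow> \<bar>real (card {k\<in>{1..K}. r \<le> (\<Sum>j<d. a j * Z k \<omega> j)}) -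
      (\<Sum>k\<in>{1..K}. prob {\<omega>\<in>space M. r \<le> (\<Sum>j<d. a j * Z k \<omega> j)})\<bar> \<le> 2 * \<tau> * real (card {1..K})"
    using halfspace_uniform_deviation[OF indepZ _ _ \<tau>] Kpos by auto

  have "8 * exp (- (\<tau>\<^sup>2 * real (card {1..K}) / 4096)) \<le> exp (- (1/131072) * \<epsilon>\<^sup>2 * real K)"
  proof -
    define t where "t = \<epsilon>\<^sup>2 * real K / 131072"
    have "6 \<le> t" using Kd d by (simp add: t_def)
    have "8 \<le> exp t"
    proof -
      have "2 \<le> exp (1 :: real)" using exp_ge_add_one_self[of 1] by simp
      then have "2 ^ 3 \<le> exp (1 :: real) ^ 3" by (intro power_mono) auto
      also have "\<dots> = exp (3 :: real)" by (simp flip: exp_of_nat_mult)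
      also have "\<dots> \<le> exp t" using \<open>6 \<le> t\<close> by simp
      finally show ?thesis by simp
    qed
    then have "8 * exp (- 2 * t) \<le> exp t * exp (- 2 * t)" by (intro mult_right_mono) auto
    also have "\<dots> = exp (- t)" by (simp flip: exp_add)
    finally show ?thesis by (simp add: t_def \<tau>_def power_divide mult.commute)
  qed
  then have probE: "1 - exp (- (1/131072) * \<epsilon>\<^sup>2 * real K) \<le> prob E" using E(2) by linarith

  have "\<phi>l * sqrt (real K / real N) * euclid_norm (R *\<^sub>v v) \<le> MOMAD d K B (\<lambda>i. X i \<omega>) v \<and>
      MOMAD d K B (\<lambda>i. X i \<omega>) v \<le> \<phi>u * sqrt (real K / real N) * euclid_norm (R *\<^sub>v v)"
    if \<omega>: "\<omega> \<in> E" and v: "v \<in> carrier_vec d" for \<omega> v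
  proof -
    have \<omega>M: "\<omega> \<in> space M" using \<omega> E(1) sets.sets_into_space by blast
    define y where "y = (\<lambda>k. scalar_prod (block_mean d (\<lambda>i. X i \<omega>) (B k)) v)"
    define \<nu> where "\<nu> = euclid_norm (R *\<^sub>v v)"
    have Rv: "R *\<^sub>v v \<in> carrier_vec d" using RC v by auto
    have MOMAD: "MOMAD d K B (\<lambda>i. X i \<omega>) v = Med K (\<lambda>k. \<bar>y k - Med K y\<bar>)"
      by (simp add: MOMAD_def y_def)
    show ?thesis
    proof (cases "\<nu> = 0")
      case True
      have "R *\<^sub>v v = 0\<^sub>v d" by (rule euclid_norm_eq_0[OF Rv]) (use True in \<open>simp add: \<nu>_def\<close>)
      note T = psd_sqrt_inverse[OF R]
      have "v = the (mat_inverse R) *\<^sub>v (R *\<^sub>v v)"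
        using assoc_mult_mat_vec[OF T(1) RC v] T(3) v by simp
      also have "\<dots> = 0\<^sub>v d" unfolding \<open>R *\<^sub>v v = 0\<^sub>v d\<close> using T(1) by (intro eq_vecI) auto
      finally have "v = 0\<^sub>v d" .
      then have y0: "y = (\<lambda>_. 0)" by (simp add: y_def block_mean_def fun_eq_iff)
      have Med0: "Med K (\<lambda>_. 0) = 0"
      proof -
        have "{k\<in>{1..K}. (0 :: real) \<le> 0} = {1..K}" by auto
        then have "K < 2 * card {k\<in>{1..K}. (0 :: real) \<le> 0}" using Kpos by (simp only: card_atLeastAtMost)
        then show ?thesis by (intro antisym Med_le Med_ge)
      qed
      show ?thesis using True unfolding MOMAD y0 by (simp add: Med0 \<nu>_def)
    next
      case False
      then have \<nu>: "0 < \<nu>" using euclid_norm_nonneg[of "R *\<^sub>v v"] by (simp add: \<nu>_def)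
      define u where "u = (1 / \<nu>) \<cdot>\<^sub>v (R *\<^sub>v v)"
      have u: "u \<in> carrier_vec d" "euclid_norm u = 1"
        using Rv euclid_norm_normalize[OF Rv] False by (auto simp: u_def \<nu>_def)
      define c where "c = scalar_prod \<mu> v"
      define s where "s = \<nu> / sqrt (real n)"
      have s: "0 < s" using \<nu> n by (simp add: s_def)
      have s_eq: "s = sqrt (real K / real N) * \<nu>"
        using Kpos n by (simp add: s_def N real_sqrt_divide)
      \<comment> \<open>\<open>z k\<close> is the projection of the uncorrupted block mean, \<open>y k\<close> that of the corrupted one.\<close>
      define z where "z = (\<lambda>k \<omega>. \<Sum>j<d. vec_index v j * Z k \<omega> j)"
      define h where "h = H_fun M Xt \<mu> R N K u"
      have std: "r \<le> 1 / sqrt (real (card (B k))) *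
          (\<Sum>i\<in>B k. scalar_prod (the (mat_inverse R) *\<^sub>v (Xt i \<omega>' - \<mu>)) u) \<longleftrightarrow> c + s * r \<le> z k \<omega>'"
        if k: "k \<in> {1..K}" and \<omega>': "\<omega>' \<in> space M" for k r \<omega>'
      proof -
        have "1 / sqrt (real (card (B k))) *
            (\<Sum>i\<in>B k. scalar_prod (the (mat_inverse R) *\<^sub>v (Xt i \<omega>' - \<mu>)) u) =
            1 / \<nu> * sqrt (real (card (B k))) * (scalar_prod (block_mean d (\<lambda>i. Xt i \<omega>') (B k)) v - scalar_prod \<mu> v)"
          unfolding u_def
          by (rule standardized_sum_eq[OF R \<mu> v]) (use XtC Bsub[OF k] \<omega>' cardB[OF k] n in auto)
        also have "\<dots> = (z k \<omega>' - c) / s"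
          unfolding z_def Z_eq[OF v] c_def s_def using cardB[OF k] by simp
        finally have eq: "1 / sqrt (real (card (B k))) *
            (\<Sum>i\<in>B k. scalar_prod (the (mat_inverse R) *\<^sub>v (Xt i \<omega>' - \<mu>)) u) = (z k \<omega>' - c) / s" .
        show ?thesis unfolding eq using s by (simp add: field_simps)
      qed
      have h_eq: "prob {\<omega>'\<in>space M. c + s * r \<le> z k \<omega>'} = h r" if k: "k \<in> {1..K}" for k r
      proof -
        have "h r = std_tail M Xt \<mu> R (B k) u r"
          using law k u by (simp add: common_block_law_def h_def)
        also have "\<dots> = prob {\<omega>'\<in>space M. c + s * r \<le> z k \<omega>'}"
          unfolding std_tail_def using std[OF k] by (intro arg_cong[where f = prob]) auto
        finally show ?thesis ..
      qed
      have clean: "\<bar>real (card {k\<in>{1..K}. c + s * r \<le> z k \<omega>}) - real K * h r\<bar> \<le> \<epsilon> / 2 * real K" for r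
      proof -
        have "(\<Sum>k\<in>{1..K}. prob {\<omega>'\<in>space M. c + s * r \<le> z k \<omega>'}) = (\<Sum>k\<in>{1..K}. h r)"
          by (rule sum.cong[OF refl h_eq])
        then show ?thesis using dev[OF \<omega>, of "c + s * r" "vec_index v"] by (simp add: z_def \<tau>_def)
      qed
      have modified: "card {k\<in>{1..K}. y k \<noteq> z k \<omega>} \<le> m"
      proof (rule card_modified_blocks_le[OF B])
        show "card {i\<in>{1..N}. X i \<omega> \<noteq> Xt i \<omega>} \<le> m"
          using X \<omega>M by (simp add: corrupted_version_def)
        show "y k = z k \<omega>" if "\<And>i. i \<in> B k \<Longrightarrow> X i \<omega> = Xt i \<omega>" for k
          unfolding y_def z_def Z_eq[OF v] block_mean_def using that by (simp cong: sum.cong)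
      qed
      have count: "\<bar>real (card {k\<in>{1..K}. c + s * r \<le> y k}) - real K * h r\<bar> < 2 * \<epsilon> * real K" for r
      proof -
        have 1: "card {k\<in>{1..K}. c + s * r \<le> y k} \<le> card {k\<in>{1..K}. c + s * r \<le> z k \<omega>} + m"
          by (rule card_le_card_add_modified[OF _ modified]) simp
        have "{k\<in>{1..K}. z k \<omega> \<noteq> y k} = {k\<in>{1..K}. y k \<noteq> z k \<omega>}" by auto
        then have "card {k\<in>{1..K}. z k \<omega> \<noteq> y k} \<le> m" using modified by (simp only:)
        then have 2: "card {k\<in>{1..K}. c + s * r \<le> z k \<omega>} \<le> card {k\<in>{1..K}. c + s * r \<le> y k} + m"
          by (intro card_le_card_add_modified) simp_all
        have "0 < \<epsilon> * real K" using \<epsilon> Kpos by simp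
        then show ?thesis using 1 2 clean[of r] m by linarith
      qed
      define w where "w = W_fun M Xt \<mu> R N K u"
      have wh: "p \<le> h (w p)" "\<And>r. w p < r \<Longrightarrow> h r < p" if p: "0 < p" "p < 1" for p
      proof -
        \<comment> \<open>All blocks have the same projected law, so the first one can represent \<open>h\<close>.\<close>
        define V where "V = (\<lambda>\<omega>'. (z 1 \<omega>' - c) / s)"
        have "Z 1 \<in> measurable M (PiM {..<d} (\<lambda>_. borel))"
          using indepZ Kpos by (auto simp: indep_vars_def)
        then have "(\<lambda>\<omega>'. Z 1 \<omega>' j) \<in> borel_measurable M" if "j < d" for j
          using measurable_compose[OF _ measurable_component_singleton[of j "{..<d}"]] that by blast
        then have V: "V \<in> borel_measurable M"
          unfolding V_def z_def by (intro borel_measurable_divide borel_measurable_diff borel_measurable_sum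
            borel_measurable_times borel_measurable_const) auto
        have hV: "h r = prob {\<omega>'\<in>space M. r \<le> V \<omega>'}" for r
          using h_eq[of 1 r] Kpos s by (simp add: V_def field_simps)
        have "w p = (GREATEST r. p \<le> prob {\<omega>'\<in>space M. r \<le> V \<omega>'})"
          unfolding w_def W_fun_def h_def[symmetric] hV ..
        then show "p \<le> h (w p)" "\<And>r. w p < r \<Longrightarrow> h r < p"
          using upper_quantile[OF V p] by (simp_all add: hV)
      qed
      note at_least = counts_at_quantiles(1)[OF Kpos(1) s count]
      note above = counts_at_quantiles(2)[OF Kpos(1) s count]
      have g: "w (1/4 - 2*\<epsilon>) - w (1/2 + 2*\<epsilon>) \<le> \<phi>u" "w (1/2 - 2*\<epsilon>) - w (3/4 + 2*\<epsilon>) \<le> \<phi>u"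
          "\<phi>l \<le> w (1/4 + 2*\<epsilon>) - w (1/2 - 2*\<epsilon>)" "\<phi>l \<le> w (1/2 + 2*\<epsilon>) - w (3/4 - 2*\<epsilon>)"
        using gaps[OF u] by (simp_all add: Let_def w_def)
      have a14: "real (card {k\<in>{1..K}. c + s * w (1/4 - 2*\<epsilon>) < y k}) < 1/4 * real K"
        by (rule above) (rule wh(2); use \<epsilon> in simp)
      have a12: "real (card {k\<in>{1..K}. c + s * w (1/2 - 2*\<epsilon>) < y k}) < 1/2 * real K"
        by (rule above) (rule wh(2); use \<epsilon> in simp)
      have a34: "real (card {k\<in>{1..K}. c + s * w (3/4 - 2*\<epsilon>) < y k}) < 3/4 * real K"
        by (rule above) (rule wh(2); use \<epsilon> in simp)
      have l14: "1/4 * real K < real (card {k\<in>{1..K}. c + s * w (1/4 + 2*\<epsilon>) \<le> y k})"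
        by (rule at_least) (rule wh(1); use \<epsilon> in simp)
      have l12: "1/2 * real K < real (card {k\<in>{1..K}. c + s * w (1/2 + 2*\<epsilon>) \<le> y k})"
        by (rule at_least) (rule wh(1); use \<epsilon> in simp)
      have l34: "3/4 * real K < real (card {k\<in>{1..K}. c + s * w (3/4 + 2*\<epsilon>) \<le> y k})"
        by (rule at_least) (rule wh(1); use \<epsilon> in simp)
      have scale: "s * a - s * b \<le> s * e" if "a - b \<le> e" for a b e
        using mult_left_mono[OF that, of s] s by (simp add: right_diff_distrib)
      have scale': "s * e \<le> s * a - s * b" if "e \<le> a - b" for a b e
        using mult_left_mono[OF that, of s] s by (simp add: right_diff_distrib)
      have A: "4 * card {k\<in>{1..K}. c + s * w (1/4 - 2*\<epsilon>) < y k} < K"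
          "2 * card {k\<in>{1..K}. c + s * w (1/2 - 2*\<epsilon>) < y k} < K"
          "4 * card {k\<in>{1..K}. c + s * w (3/4 - 2*\<epsilon>) < y k} < 3 * K"
        using a14 a12 a34 by linarith+
      have L: "K < 4 * card {k\<in>{1..K}. c + s * w (1/4 + 2*\<epsilon>) \<le> y k}"
          "K < 2 * card {k\<in>{1..K}. c + s * w (1/2 + 2*\<epsilon>) \<le> y k}"
          "3 * K < 4 * card {k\<in>{1..K}. c + s * w (3/4 + 2*\<epsilon>) \<le> y k}"
        using l14 l12 l34 by linarith+
      have "0 < s * \<phi>l" using s \<phi> by simp
      then have "s * \<phi>l \<le> Med K (\<lambda>k. \<bar>y k - Med K y\<bar>)" "Med K (\<lambda>k. \<bar>y k - Med K y\<bar>) \<le> s * \<phi>u"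
        using MAD_bounds[OF A L, of "s * \<phi>u" "s * \<phi>l"]
          scale[OF g(1)] scale[OF g(2)] scale'[OF g(3)] scale'[OF g(4)] by simp_all
      then show ?thesis unfolding MOMAD s_eq \<nu>_def by (simp add: mult_ac)
    qed
  qed
  then show ?thesis using E(1) probE by blast
qed

theorem proposition2:
  shows "\<exists>c0>0::real. \<exists>c1>0::real.
    \<forall>(N::nat) (d::nat) (K::nat) (B :: nat \<Rightarrow> nat set)
      (M :: 'a measure) (Xt :: nat \<Rightarrow> 'a \<Rightarrow> real Matrix.vec) (X :: nat \<Rightarrow> 'a \<Rightarrow> real Matrix.vec)
      (\<mu> :: real Matrix.vec) (\<Sigma> :: real mat) (R :: real mat)
      (m::nat) (\<epsilon>::real) (\<phi>l::real) (\<phi>u::real).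
      N \<ge> 1 \<longrightarrow> d \<ge> 1 \<longrightarrow> K \<in> {1..N} \<longrightarrow> K dvd N \<longrightarrow>
      is_block_partition N K B \<longrightarrow>
      prob_space M \<longrightarrow>
      prob_space.indep_vars M (\<lambda>_. borel_vec d) Xt {1..N} \<longrightarrow>
      (\<forall>i\<in>{1..N}. has_mean M d (Xt i) \<mu>) \<longrightarrow>
      (\<forall>i\<in>{1..N}. has_covariance M d (Xt i) \<mu> \<Sigma>) \<longrightarrow>
      invertible_mat \<Sigma> \<longrightarrow>
      is_psd_sqrt d R \<Sigma> \<longrightarrow>
      common_block_law M Xt \<mu> R d N K B \<longrightarrow>
      corrupted_version M d N m Xt X \<longrightarrow>
      0 < \<epsilon> \<longrightarrow> \<epsilon> < 1/8 \<longrightarrow> 0 < \<phi>l \<longrightarrow> \<phi>l < \<phi>u \<longrightarrow>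
      (\<forall>v\<in>carrier_vec d. euclid_norm v = 1 \<longrightarrow>
        (let w = W_fun M Xt \<mu> R N K v in
          max (w (1/4 - 2*\<epsilon>) - w (1/2 + 2*\<epsilon>)) (w (1/2 - 2*\<epsilon>) - w (3/4 + 2*\<epsilon>)) \<le> \<phi>u \<and>
          min (w (1/4 + 2*\<epsilon>) - w (1/2 - 2*\<epsilon>)) (w (1/2 + 2*\<epsilon>) - w (3/4 - 2*\<epsilon>)) \<ge> \<phi>l)) \<longrightarrow>
      real m \<le> \<epsilon> * real K \<longrightarrow>
      real K \<ge> c0 * (1 / \<epsilon>\<^sup>2) * real d \<longrightarrow>
      (\<exists>E\<in>sets M. measure M E \<ge> 1 - exp (- c1 * \<epsilon>\<^sup>2 * real K) \<and>
        (\<forall>\<omega>\<in>E. \<forall>v\<in>carrier_vec d.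
          \<phi>l * sqrt (real K / real N) * euclid_norm (R *\<^sub>v v) \<le> MOMAD d K B (\<lambda>i. X i \<omega>) v \<and>
          MOMAD d K B (\<lambda>i. X i \<omega>) v \<le> \<phi>u * sqrt (real K / real N) * euclid_norm (R *\<^sub>v v)))"
proof (rule exI[of _ 786432], rule conjI, simp, rule exI[of _ "1/131072"], rule conjI, simp, intro allI impI)
  fix N d K :: nat and B :: "nat \<Rightarrow> nat set" and M :: "'a measure"
    and Xt X :: "nat \<Rightarrow> 'a \<Rightarrow> real Matrix.vec" and \<mu> :: "real Matrix.vec" and \<Sigma> R :: "real mat"
    and m :: nat and \<epsilon> \<phi>l \<phi>u :: real
  assume N: "1 \<le> N" and d: "1 \<le> d" and K: "K \<in> {1..N}" "K dvd N"
    and B: "is_block_partition N K B" and M: "prob_space M"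
    and indep: "prob_space.indep_vars M (\<lambda>_. borel_vec d) Xt {1..N}"
    and mean: "\<forall>i\<in>{1..N}. has_mean M d (Xt i) \<mu>"
    and inv: "invertible_mat \<Sigma>" and R: "is_psd_sqrt d R \<Sigma>"
    and law: "common_block_law M Xt \<mu> R d N K B" and X: "corrupted_version M d N m Xt X"
    and \<epsilon>: "0 < \<epsilon>" "\<epsilon> < 1/8" and \<phi>: "0 < \<phi>l"
    and gaps: "\<forall>v\<in>carrier_vec d. euclid_norm v = 1 \<longrightarrow>
        (let w = W_fun M Xt \<mu> R N K v in
          max (w (1/4 - 2*\<epsilon>) - w (1/2 + 2*\<epsilon>)) (w (1/2 - 2*\<epsilon>) - w (3/4 + 2*\<epsilon>)) \<le> \<phi>u \<and>
          min (w (1/4 + 2*\<epsilon>) - w (1/2 - 2*\<epsilon>)) (w (1/2 + 2*\<epsilon>) - w (3/4 - 2*\<epsilon>)) \<ge> \<phi>l)"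
    and m: "real m \<le> \<epsilon> * real K" and Kd: "786432 * (1 / \<epsilon>\<^sup>2) * real d \<le> real K"
  interpret prob_space M by (rule M)
  have "\<mu> \<in> carrier_vec d" using mean N by (auto simp: has_mean_def)
  moreover have "786432 * real d \<le> \<epsilon>\<^sup>2 * real K" using Kd \<epsilon>(1) by (simp add: field_simps)
  ultimately show "\<exists>E\<in>sets M. measure M E \<ge> 1 - exp (- (1/131072) * \<epsilon>\<^sup>2 * real K) \<and>
        (\<forall>\<omega>\<in>E. \<forall>v\<in>carrier_vec d.
          \<phi>l * sqrt (real K / real N) * euclid_norm (R *\<^sub>v v) \<le> MOMAD d K B (\<lambda>i. X i \<omega>) v \<and>
          MOMAD d K B (\<lambda>i. X i \<omega>) v \<le> \<phi>u * sqrt (real K / real N) * euclid_norm (R *\<^sub>v v))"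
    using MOMAD_bounds[OF K d B indep _ R inv law X \<epsilon> \<phi> _ m] gaps by blast
qed

end
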